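(* Let $\varepsilon>0$, let $\omega\in\mathbb{R}$ be an algebraic irrational number of degree $2$, and let $\vec\omega=(1,\omega)\in\mathbb{R}^2$ (so $\nu=2$). Let $p\in[6,\infty)$. Then there is a constant $K$ depending only on $\varepsilon,\omega,p$ such that for all $C\ge 1$, all $T>C^{2+\varepsilon}$ and all $f\in\mathcal{T}_{\vec\omega}(\mathbb{R})$, $$\|e^{2\pi i tD_x^2}R_Cf\|_{L^p_t\mathcal{L}^p_x([0,T]\times\mathbb{R})}\le K\Bigl\{1+\Bigl(\frac{T}{C^2}\Bigr)^{\frac1p}\Bigr\}C^{1-\frac4p+\varepsilon}\,\|R_Cf\|_{\mathcal{L}^2(\mathbb{R})}.$$
   Context: A vector $\vec\omega\in\mathbb{R}^\nu$ is non-resonant if its components are linearly independent over $\mathbb{Q}$ (here $(1,\omega)$ with $\omega$ irrational is non-resonant). $\mathcal{T}_{\vec\omega}(\mathbb{R})$ is the set of trigonometric polynomials $f(x)=\sum_{k\in\mathbb{Z}^\nu}a_ke^{2\pi i(k\cdot\vec\omega)x}$, $x\in\mathbb{R}$, with only finitely many nonzero $a_k\in\mathbb{C}$; write $\widehat f(k\cdot\vec\omega)=a_k$. For $1\le p<\infty$, $\|f\|_{\mathcal{L}^p(\mathbb{R})}^p:=\limsup_{L\to\infty}\frac1{2L}\int_{-L}^{L}|f(x)|^p\,dx$, and $\|u\|_{L^p_t\mathcal{L}^p_x([0,T]\times\mathbb{R})}:=\bigl(\int_0^T\|u(t,\cdot)\|_{\mathcal{L}^p(\mathbb{R})}^p\,dt\bigr)^{1/p}$.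 The height projection is $R_Cf(x)=\sum_{k\in\mathbb{Z}^\nu,\ C/2\le|k|<C}\widehat f(k\cdot\vec\omega)e^{2\pi i(k\cdot\vec\omega)x}$, with $|k|$ the Euclidean norm. The Schrödinger propagator is $e^{2\pi itD_x^2}f(x)=\sum_{k\in\mathbb{Z}^\nu}e^{2\pi i[(k\cdot\vec\omega)x+|k\cdot\vec\omega|^2t]}\widehat f(k\cdot\vec\omega)$. *)

theory Defs
  imports "HOL-Analysis.Analysis" "HOL-Computational_Algebra.Polynomial"
begin

text \<open>Only meaningful for algebraic numbers.\<close>

definition alg_degree :: "real \<Rightarrow> nat" where
  "alg_degree x = (LEAST n. \<exists>q :: real poly. (\<forall>i. coeff q i \<in> \<rat>) \<and> q \<noteq> 0 \<and> poly q x = 0 \<and> degree q = n)"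

definition lattice_vec :: "int ^ 'n \<Rightarrow> real ^ 'n" where
  "lattice_vec k = (\<chi> i. real_of_int (k $ i))"

definition freq :: "real ^ 'n \<Rightarrow> int ^ 'n \<Rightarrow> real" where
  "freq w k = lattice_vec k \<bullet> w"

text \<open>Sums over all of the lattice are written as finite sums over the support of the
  coefficient family; \<^const>\<open>cis\<close> \<open>\<theta>\<close> is \<open>e\<^sup>i\<^sup>\<theta>\<close>.\<close>

definition trig_sum :: "real ^ 'n \<Rightarrow> (int ^ 'n \<Rightarrow> complex) \<Rightarrow> real \<Rightarrow> complex" where
  "trig_sum w a x = (\<Sum>k | a k \<noteq> 0. a k * cis (2 * pi * freq w k * x))"

definition trig_polys :: "real ^ 'n \<Rightarrow> (real \<Rightarrow> complex) set" where
  "trig_polys w = {f. \<exists>a. finite {k. a k \<noteq> 0} \<and> f = trig_sum w a}"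

text \<open>The coefficient family of a trigonometric polynomial is unique when the components of
  \<open>w\<close> are linearly independent over the rationals; only then is the following meaningful.\<close>

definition trig_coeff :: "real ^ 'n \<Rightarrow> (real \<Rightarrow> complex) \<Rightarrow> int ^ 'n \<Rightarrow> complex" where
  "trig_coeff w f = (THE a. finite {k. a k \<noteq> 0} \<and> f = trig_sum w a)"

definition height_proj :: "real ^ 'n \<Rightarrow> real \<Rightarrow> (real \<Rightarrow> complex) \<Rightarrow> real \<Rightarrow> complex" where
  "height_proj w C f x =
     (\<Sum>k | trig_coeff w f k \<noteq> 0 \<and> C / 2 \<le> norm (lattice_vec k) \<and> norm (lattice_vec k) < C.
        trig_coeff w f k * cis (2 * pi * freq w k * x))"

definition schroedinger :: "real ^ 'n \<Rightarrow> real \<Rightarrow> (real \<Rightarrow> complex) \<Rightarrow> real \<Rightarrow> complex" where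
  "schroedinger w t f x =
     (\<Sum>k | trig_coeff w f k \<noteq> 0.
        cis (2 * pi * (freq w k * x + \<bar>freq w k\<bar>\<^sup>2 * t)) * trig_coeff w f k)"

text \<open>Norms take values in \<^typ>\<open>ennreal\<close>, so that no finiteness has to be presupposed. The
  power below is meant for exponents \<open>a > 0\<close>.\<close>

definition ennreal_powr :: "ennreal \<Rightarrow> real \<Rightarrow> ennreal" where
  "ennreal_powr x a = (if x = top then top else ennreal (enn2real x powr a))"

definition mean_norm :: "real \<Rightarrow> (real \<Rightarrow> complex) \<Rightarrow> ennreal" where
  "mean_norm p f =
     ennreal_powr
       (Limsup at_top (\<lambda>L :: real.
          (\<integral>\<^sup>+x\<in>{-L..L}. ennreal (norm (f x) powr p) \<partial>lborel) / ennreal (2 * L)))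
       (1 / p)"

definition mixed_norm :: "real \<Rightarrow> real \<Rightarrow> (real \<Rightarrow> real \<Rightarrow> complex) \<Rightarrow> ennreal" where
  "mixed_norm p T u =
     ennreal_powr (\<integral>\<^sup>+t\<in>{0..T}. ennreal_powr (mean_norm p (u t)) p \<partial>lborel) (1 / p)"

end

theory Submission
  imports Defs
begin

text \<open>
  Taking the mean in \<open>x\<close> of \<open>\<bar>u\<bar>\<^sup>6 = \<bar>u\<^sup>2 u\<^sup>*\<bar>\<^sup>2\<close> splits the sixth moment by the value
  \<open>s = \<xi>\<^sub>1 + \<xi>\<^sub>2 - \<xi>\<^sub>3\<close> of the spatial frequency. For fixed \<open>s\<close> the temporal frequency is
  \<open>\<xi>\<^sub>1\<^sup>2 + \<xi>\<^sub>2\<^sup>2 - \<xi>\<^sub>3\<^sup>2 = s\<^sup>2 - 2 (\<xi>\<^sub>1 - s) (\<xi>\<^sub>2 - s)\<close>. In a real quadratic order a nonzero product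
  has only \<open>O(C\<^sup>\<eta>)\<close> factorizations of height at most \<open>C\<close>, and distinct products differ by at least a
  constant times \<open>C\<^sup>-\<^sup>2\<close>, since their difference has a nonzero integral norm. The large sieve in \<open>t\<close>
  therefore bounds the sixth moment over \<open>[0, T]\<close> by \<open>(T + C\<^sup>2\<^sup>+\<^sup>\<eta>) C\<^sup>\<eta> \<parallel>f\<parallel>\<^sup>6\<close>, and larger exponents
  follow by interpolation with the trivial bound \<open>\<bar>u\<bar> \<le> 3 C \<parallel>f\<parallel>\<close>.
\<close>

section \<open>Divisors and quadratic congruences\<close>


text \<open>The obstacle is to count factorizations in an order that need not have unique
  factorization and has infinitely many units. Instead of ideals, a factor is described by
  elementary data: its norm, the gcd of its coordinates, and a root of the minimal polynomial modulo
  the norm of the remaining primitive part. Elements sharing these data differ by a unit, and the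
  height bound confines the logarithm of an embedding to an interval of length
  \<open>O(log C)\<close>, which leaves \<open>O(log C)\<close> units. Since \<open>\<omega>\<close>
  itself need not be integral, this is done for \<open>a * \<omega>\<close> with an integer
  \<open>a\<close>. The product zero has too many factorizations; it corresponds to the phase
  \<open>s\<^sup>2\<close>, whose contribution is estimated directly and without loss. The remaining
  losses are the number of factorizations and a logarithm, each at most a constant times
  \<open>C powr \<eta>\<close>; with \<open>\<eta> = p * \<epsilon> / 2\<close> the
  \<open>p\<close>-th root turns the two together into \<open>C powr \<epsilon>\<close>.\<close>

lemma card_divisors_prime_power_mult:
  fixes m p :: nat
  assumes "prime p" "m > 0"
  shows "card {d. d dvd p ^ a * m} \<le> (a + 1) * card {d. d dvd m}"
proof -
  have "{d. d dvd p ^ a * m} \<subseteq> (\<lambda>(i, e). p ^ i * e) ` ({..a} \<times> {d. d dvd m})"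
  proof
    fix d assume "d \<in> {d. d dvd p ^ a * m}"
    then obtain b c where "d = b * c" "b dvd p ^ a" "c dvd m"
      using division_decomp by blast
    moreover then obtain i where "i \<le> a" "b = p ^ i"
      using assms(1) by (metis divides_primepow_nat)
    ultimately show "d \<in> (\<lambda>(i, e). p ^ i * e) ` ({..a} \<times> {d. d dvd m})"
      by auto
  qed
  moreover have "finite ({..a} \<times> {d. d dvd m})"
    using assms(2) by simp
  ultimately have "card {d. d dvd p ^ a * m} \<le> card ({..a} \<times> {d. d dvd m})"
    by (meson surj_card_le)
  then show ?thesis
    by (simp add: card_cartesian_product)
qed

text \<open>The number of divisors is the product of \<open>a + 1\<close> over the prime powers
  \<open>p ^ a\<close> exactly dividing \<open>n\<close>. A prime with
  \<open>p powr \<eta> \<ge> 2\<close> satisfies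
  \<open>a + 1 \<le> 2 ^ a \<le> p powr (a * \<eta>)\<close>; each of the finitely many smaller
  primes costs one factor \<open>c\<close>.\<close>

lemma card_divisors_powr_bound:
  fixes \<eta> :: real
  assumes "\<eta> > 0"
  shows "\<exists>K>0. \<forall>n::nat. n > 0 \<longrightarrow> real (card {d. d dvd n}) \<le> K * real n powr \<eta>"
proof -
  \<comment> \<open>Chosen so that both \<open>c\<close> and \<open>c * \<eta> * ln 2\<close> are at
    least 1, which is what comparing \<open>a + 1\<close> with \<open>1 + a * \<eta> * ln 2\<close>
    requires.\<close>
  define c where "c = 1 + 1 / (\<eta> * ln 2)"
  define B where "B = nat \<lceil>2 powr (1 / \<eta>)\<rceil>"
  let ?P = "\<lambda>n. {p::nat. prime p \<and> p < B \<and> p dvd n}"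
  have c1: "c \<ge> 1"
    using assms by (simp add: c_def)
  have small: "real (a + 1) \<le> c * real p powr (a * \<eta>)" if "p \<ge> 2" for a p :: nat
  proof -
    have "1 + a * \<eta> * ln 2 \<le> exp (a * \<eta> * ln 2)"
      by (rule exp_ge_add_one_self)
    also have "\<dots> = 2 powr (a * \<eta>)"
      by (simp add: powr_def mult_ac)
    also have "\<dots> \<le> real p powr (a * \<eta>)"
      using that assms by (intro powr_mono2) auto
    finally have *: "1 + a * \<eta> * ln 2 \<le> real p powr (a * \<eta>)" .
    have "real (a + 1) \<le> c * (1 + a * \<eta> * ln 2)"
      using assms by (simp add: c_def field_simps)
    also have "\<dots> \<le> c * real p powr (a * \<eta>)"
      using * c1 by (intro mult_left_mono) auto
    finally show ?thesis .
  qed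
  have large: "real (a + 1) \<le> real p powr (a * \<eta>)" if "p \<ge> B" for a p :: nat
  proof -
    have "2 powr (1 / \<eta>) \<le> real p"
      using that unfolding B_def by linarith
    then have "(2 powr (1 / \<eta>)) powr (a * \<eta>) \<le> real p powr (a * \<eta>)"
      using assms by (intro powr_mono2) auto
    moreover have "(2 powr (1 / \<eta>)) powr (a * \<eta>) = 2 ^ a"
      using assms by (simp add: powr_powr powr_realpow)
    moreover have "real (a + 1) \<le> 2 ^ a"
      by (induction a) auto
    ultimately show ?thesis by linarith
  qed
  \<comment> \<open>The exponent of \<open>c\<close> counts the small primes dividing
    \<open>n\<close>, so the induction, which removes one full prime power at a time, pays
    \<open>c\<close> once per small prime and not once per step.\<close>
  have main: "real (card {d. d dvd n}) \<le> c ^ card (?P n) * real n powr \<eta>" if "n > 0" for n :: nat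
    using that
  proof (induction n rule: less_induct)
    case (less n)
    show ?case
    proof (cases "n = 1")
      case True
      then show ?thesis using c1 by (simp add: one_le_power)
    next
      case False
      then obtain p where p: "prime p" "p dvd n"
        using prime_factor_nat by blast
      define a where "a = multiplicity p n"
      obtain m where m: "n = p ^ a * m" "\<not> p dvd m"
        using multiplicity_decompose'[of n p] less.prems p unfolding a_def
        by (metis mult.commute not_gr_zero not_prime_unit)
      have p2: "p \<ge> 2" using p(1) prime_ge_2_nat by blast
      have a0: "a > 0" using m p by (metis gr0I mult_1 power_0)
      have m0: "m > 0" using m less.prems by (cases m) auto
      have "p ^ a > 1" using p2 a0 by (intro one_less_power) auto
      then have "m < n" using m m0 by simp
      then have IH: "real (card {d. d dvd m}) \<le> c ^ card (?P m) * real m powr \<eta>"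
        using less.IH m0 by blast
      have "real (card {d. d dvd n}) \<le> real (a + 1) * real (card {d. d dvd m})"
        using card_divisors_prime_power_mult[OF p(1) m0, of a] m(1)
        by (metis of_nat_le_iff of_nat_mult)
      also have "\<dots> \<le> real (a + 1) * (c ^ card (?P m) * real m powr \<eta>)"
        using IH by (intro mult_left_mono) auto
      also have "\<dots> \<le> c ^ card (?P n) * real p powr (a * \<eta>) * real m powr \<eta>"
      proof (cases "p < B")
        case True
        have "insert p (?P m) \<subseteq> ?P n" using m p True by auto
        then have "card (insert p (?P m)) \<le> card (?P n)"
          by (intro card_mono) auto
        moreover have "card (insert p (?P m)) = Suc (card (?P m))"
          using m(2) by (intro card_insert_disjoint) auto
        ultimately have "c * c ^ card (?P m) \<le> c ^ card (?P n)"
          using c1 by (metis power_Suc power_increasing)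
        then have "c ^ card (?P m) * (c * real p powr (a * \<eta>))
            \<le> c ^ card (?P n) * real p powr (a * \<eta>)"
          using mult_right_mono[of "c * c ^ card (?P m)" "c ^ card (?P n)" "real p powr (a * \<eta>)"]
          by (simp add: mult_ac)
        moreover have "c ^ card (?P m) * real (a + 1) \<le> c ^ card (?P m) * (c * real p powr (a * \<eta>))"
          using small[OF p2] c1 by (intro mult_left_mono) auto
        ultimately have "real (a + 1) * c ^ card (?P m) \<le> c ^ card (?P n) * real p powr (a * \<eta>)"
          by (simp add: mult.commute)
        from mult_right_mono[OF this, of "real m powr \<eta>"] show ?thesis
          by (simp add: mult_ac)
      next
        case False
        have "?P m \<subseteq> ?P n" using m by auto
        then have "card (?P m) \<le> card (?P n)" by (intro card_mono) auto
        then have "c ^ card (?P m) \<le> c ^ card (?P n)"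
          using c1 by (simp add: power_increasing)
        then have "real (a + 1) * c ^ card (?P m) \<le> real p powr (a * \<eta>) * c ^ card (?P n)"
          using large[of p a] False c1 by (intro mult_mono) auto
        from mult_right_mono[OF this, of "real m powr \<eta>"] show ?thesis
          by (simp add: mult_ac)
      qed
      also have "\<dots> = c ^ card (?P n) * real n powr \<eta>"
        using p2 m0 by (simp add: m(1) powr_mult powr_powr powr_realpow[symmetric])
      finally show ?thesis .
    qed
  qed
  have "real (card {d. d dvd n}) \<le> c ^ B * real n powr \<eta>" if "n > 0" for n :: nat
  proof -
    have "card (?P n) \<le> card {..<B}" by (intro card_mono) auto
    then have "c ^ card (?P n) \<le> c ^ B" using c1 by (simp add: power_increasing)
    then show ?thesis
      using main[OF that] mult_right_mono[of "c ^ card (?P n)" "c ^ B" "real n powr \<eta>"] by simp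
  qed
  then show ?thesis using c1 by (intro exI[of _ "c ^ B"]) auto
qed


text \<open>The counting below fixes one invariant of the counted elements at a time; each invariant
  contributes the number of its values as a factor.\<close>

lemma card_le_of_fibers:
  fixes f :: "'a \<Rightarrow> 'b" and B :: real
  assumes "finite A" "f ` S \<subseteq> A" "\<And>y. y \<in> A \<Longrightarrow> real (card {x\<in>S. f x = y}) \<le> B"
  shows "real (card S) \<le> real (card A) * B"
proof -
  have "S = (\<Union>y\<in>A. {x\<in>S. f x = y})"
    using assms(2) by blast
  then have "card S \<le> (\<Sum>y\<in>A. card {x\<in>S. f x = y})"
    using card_UN_le[OF assms(1), of "\<lambda>y. {x\<in>S. f x = y}"] by simp
  then have "real (card S) \<le> (\<Sum>y\<in>A. real (card {x\<in>S. f x = y}))"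
    by (metis of_nat_le_iff of_nat_sum)
  also have "\<dots> \<le> real (card A) * B"
    using assms(3) by (intro sum_bounded_above) auto
  finally show ?thesis .
qed

text \<open>Congruent residues share the remainder modulo \<open>q\<close>, so the quotients, which
  lie in \<open>{0..<h}\<close>, tell them apart.\<close>

lemma card_congruent_residues_le:
  fixes q h :: int
  assumes "q > 0" "h > 0" "F \<subseteq> {0..<q * h}" "\<And>r r'. r \<in> F \<Longrightarrow> r' \<in> F \<Longrightarrow> q dvd r - r'"
  shows "card F \<le> nat h"
proof -
  have "inj_on (\<lambda>r. r div q) F"
  proof (rule inj_onI)
    fix r r' assume r: "r \<in> F" "r' \<in> F" "r div q = r' div q"
    then have "r mod q = r' mod q" using assms(4) by (simp add: mod_eq_dvd_iff)
    then show "r = r'" using r(3) by (metis div_mult_mod_eq)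
  qed
  moreover have "(\<lambda>r. r div q) ` F \<subseteq> {0..<h}"
  proof
    fix y assume "y \<in> (\<lambda>r. r div q) ` F"
    then obtain r where r: "r \<in> F" "y = r div q" by blast
    then have "0 \<le> r" "r < q * h" using assms(3) by auto
    moreover have "q * (r div q) \<le> r"
      using assms(1) pos_mod_sign[of q r] mult_div_mod_eq[of q r] by linarith
    ultimately have "q * (r div q) < q * h" by linarith
    then show "y \<in> {0..<h}"
      using assms(1) r(2) \<open>0 \<le> r\<close> by (simp add: pos_imp_zdiv_nonneg_iff)
  qed
  ultimately have "card F \<le> card {0..<h}"
    by (metis card_image card_mono finite_atLeastLessThan_int)
  then show ?thesis by simp
qed

text \<open>The polynomial is the one with trace \<open>t\<close> and norm \<open>n\<close>. Its
  roots modulo \<open>d\<close> stand in for the ideals of norm \<open>d\<close> that no integer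
  above 1 divides.\<close>

definition quadratic_roots_mod :: "int \<Rightarrow> int \<Rightarrow> int \<Rightarrow> int set" where
  "quadratic_roots_mod t n d = {r \<in> {0..<d}. d dvd r\<^sup>2 - t * r + n}"

lemma finite_quadratic_roots_mod [simp]: "finite (quadratic_roots_mod t n d)"
  by (rule finite_subset[of _ "{0..<d}"]) (auto simp: quadratic_roots_mod_def)

text \<open>If \<open>r\<^sub>0\<close> is a root, any root \<open>r\<close> with \<open>e = gcd (r - r\<^sub>0) d\<close> satisfies
  \<open>r \<equiv> r\<^sub>0\<close> modulo \<open>e\<close> and \<open>r \<equiv> t - r\<^sub>0\<close> modulo \<open>d / e\<close>; the gcd of these two moduli divides the
  discriminant.\<close>

lemma card_quadratic_roots_mod_le:
  fixes t n d :: int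
  assumes "d > 0" and disc: "t\<^sup>2 - 4 * n \<noteq> 0"
  shows "real (card (quadratic_roots_mod t n d))
    \<le> real (card {e. e dvd nat d}) * real_of_int \<bar>t\<^sup>2 - 4 * n\<bar>"
proof (cases "quadratic_roots_mod t n d = {}")
  case True
  then show ?thesis by simp
next
  case False
  then obtain r0 where r0: "d dvd r0\<^sup>2 - t * r0 + n"
    by (auto simp: quadratic_roots_mod_def)
  show ?thesis
  proof (rule card_le_of_fibers[where f = "\<lambda>r. nat (gcd (r - r0) d)"])
    show "finite {e. e dvd nat d}"
      using assms(1) by simp
    show "(\<lambda>r. nat (gcd (r - r0) d)) ` quadratic_roots_mod t n d \<subseteq> {e. e dvd nat d}"
      using assms(1) by (auto simp: nat_dvd_iff)
  next
    fix e :: nat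
    let ?F = "{r \<in> quadratic_roots_mod t n d. nat (gcd (r - r0) d) = e}"
    show "real (card ?F) \<le> real_of_int \<bar>t\<^sup>2 - 4 * n\<bar>"
    proof (cases "?F = {}")
      case True
      then show ?thesis by (simp only: card.empty)
    next
      case False
      then obtain r1 where r1: "r1 \<in> ?F" by blast
      define c where "c = int e"
      have c: "c dvd d" "c > 0"
        using r1 assms(1) by (auto simp: c_def)
      define h where "h = gcd c (d div c)"
      have h: "h > 0" "h dvd c" "h dvd d div c"
        using c by (auto simp: h_def)
      have key: "c dvd r - r0 \<and> d div c dvd r + r0 - t" if "r \<in> ?F" for r
      proof
        have cg: "c = gcd (r - r0) d" using that assms(1) by (auto simp: c_def)
        then show "c dvd r - r0" by simp
        have "d dvd (r\<^sup>2 - t * r + n) - (r0\<^sup>2 - t * r0 + n)"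
          using that r0 by (intro dvd_diff) (auto simp: quadratic_roots_mod_def)
        also have "\<dots> = (r - r0) * (r + r0 - t)"
          by (simp add: algebra_simps power2_eq_square)
        finally have "c * (d div c) dvd c * (((r - r0) div c) * (r + r0 - t))"
          using c \<open>c dvd r - r0\<close> by (simp add: mult.assoc[symmetric])
        then have "d div c dvd ((r - r0) div c) * (r + r0 - t)"
          using c(2) by (metis dvd_times_left_cancel_iff less_irrefl)
        moreover have "coprime (d div c) ((r - r0) div c)"
          using c cg by (metis coprime_commute div_gcd_coprime assms(1) less_irrefl)
        ultimately show "d div c dvd r + r0 - t"
          by (simp add: coprime_dvd_mult_right_iff)
      qed
      have "h dvd (r1 + r0 - t) - (r1 - r0)"
        using key[OF r1] h by (meson dvd_diff dvd_trans)
      then have "h dvd 2 * r0 - t" by (simp add: algebra_simps)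
      \<comment> \<open>Completing the square: four times the polynomial at \<open>r0\<close>
        differs from \<open>(2 * r0 - t)\<^sup>2\<close> by the discriminant.\<close>
      then have "h dvd (2 * r0 - t)\<^sup>2 - 4 * (r0\<^sup>2 - t * r0 + n)"
        using r0 h c by (meson dvd_diff dvd_mult dvd_power dvd_trans zero_less_numeral)
      also have "\<dots> = t\<^sup>2 - 4 * n"
        by (simp add: algebra_simps power2_eq_square)
      finally have hD: "h \<le> \<bar>t\<^sup>2 - 4 * n\<bar>"
        using disc dvd_imp_le_int[of "t\<^sup>2 - 4 * n" h] by linarith
      \<comment> \<open>The two congruences amount to one modulo the lcm, and the interval
        \<open>{0..<d}\<close> consists of exactly \<open>h\<close> periods of it.\<close>
      have lcm: "lcm c (d div c) * h = d"
        using lcm_mult_gcd[of c "d div c"] c assms(1) zero_less_mult_pos[of c "d div c"]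
        by (simp add: h_def normalize_mult abs_of_pos)
      have "card ?F \<le> nat h"
      proof (rule card_congruent_residues_le)
        show "lcm c (d div c) > 0" using lcm assms(1) h(1) by (metis zero_less_mult_pos2)
        show "h > 0" by fact
        show "?F \<subseteq> {0..<lcm c (d div c) * h}"
          unfolding lcm by (auto simp: quadratic_roots_mod_def)
        fix r r' assume r: "r \<in> ?F" "r' \<in> ?F"
        have "c dvd (r - r0) - (r' - r0)" "d div c dvd (r + r0 - t) - (r' + r0 - t)"
          using key[OF r(1)] key[OF r(2)] dvd_diff by blast+
        then show "lcm c (d div c) dvd r - r'" by (simp add: lcm_least)
      qed
      then show ?thesis using hD h(1) by linarith
    qed
  qed
qed

section \<open>Quadratic integers\<close>


text \<open>The pair \<open>(x, y)\<close> stands for \<open>x + y \<theta>\<close>, where \<open>\<theta>\<^sup>2 = t \<theta> - n\<close>.\<close>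

definition quadratic_norm :: "int \<Rightarrow> int \<Rightarrow> int \<times> int \<Rightarrow> int" where
  "quadratic_norm t n z = (fst z)\<^sup>2 + t * fst z * snd z + n * (snd z)\<^sup>2"

definition quadratic_emb :: "real \<Rightarrow> int \<times> int \<Rightarrow> real" where
  "quadratic_emb \<theta> z = real_of_int (fst z) + real_of_int (snd z) * \<theta>"

definition int_pair_box :: "real \<Rightarrow> (int \<times> int) set" where
  "int_pair_box C = {z. \<bar>real_of_int (fst z)\<bar> \<le> C \<and> \<bar>real_of_int (snd z)\<bar> \<le> C}"

lemma finite_int_pair_box [simp]: "finite (int_pair_box C)"
proof (rule finite_subset)
  show "int_pair_box C \<subseteq> {-\<lceil>C\<rceil>..\<lceil>C\<rceil>} \<times> {-\<lceil>C\<rceil>..\<lceil>C\<rceil>}"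
    by (auto simp: int_pair_box_def) linarith+
qed simp

text \<open>\<open>\<theta>'\<close> is the algebraic conjugate of \<open>\<theta>\<close>. Since
  trace and norm are symmetric, every result can also be read with the two embeddings exchanged, by
  \<open>conj_real_quadratic\<close>.\<close>

locale real_quadratic =
  fixes t n :: int and \<theta> \<theta>' :: real
  assumes trace: "\<theta> + \<theta>' = of_int t" and norm_eq: "\<theta> * \<theta>' = of_int n"
    and irrational: "\<theta> \<notin> \<rat>"
begin

lemma disc_eq: "of_int (t\<^sup>2 - 4 * n) = (\<theta> - \<theta>')\<^sup>2"
  using trace norm_eq by (simp add: power2_eq_square algebra_simps flip: trace)

lemma conj_neq: "\<theta> \<noteq> \<theta>'"
proof
  assume "\<theta> = \<theta>'"
  then have "\<theta> = of_int t / 2" using trace by simp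
  then show False using irrational by (metis Rats_divide Rats_number_of Rats_of_int)
qed

lemma disc_neq_0: "t\<^sup>2 - 4 * n \<noteq> 0"
  using disc_eq conj_neq by (metis of_int_0 eq_iff_diff_eq_0 power_eq_0_iff)

lemma conj_irrational: "\<theta>' \<notin> \<rat>"
  using trace irrational by (metis Rats_diff Rats_of_int add_diff_cancel_right')

lemma norm_eq_mult: "of_int (quadratic_norm t n z) = quadratic_emb \<theta> z * quadratic_emb \<theta>' z"
  by (simp add: quadratic_norm_def quadratic_emb_def power2_eq_square algebra_simps
      flip: trace norm_eq)

end

lemma quadratic_emb_eq_0_iff:
  assumes "\<theta> \<notin> \<rat>"
  shows "quadratic_emb \<theta> z = 0 \<longleftrightarrow> z = (0, 0)"
proof
  assume *: "quadratic_emb \<theta> z = 0"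
  have "snd z = 0"
  proof (rule ccontr)
    assume "snd z \<noteq> 0"
    then have "\<theta> = - real_of_int (fst z) / real_of_int (snd z)"
      using * by (simp add: quadratic_emb_def field_simps)
    then show False using assms
      by (metis Rats_divide Rats_minus_iff Rats_of_int)
  qed
  then show "z = (0, 0)" using * by (simp add: quadratic_emb_def prod_eq_iff)
qed (simp add: quadratic_emb_def)

lemma quadratic_emb_diff: "quadratic_emb \<theta> z - quadratic_emb \<theta> z' = quadratic_emb \<theta> (z - z')"
  by (simp add: quadratic_emb_def algebra_simps)

lemma inj_quadratic_emb:
  assumes "\<theta> \<notin> \<rat>"
  shows "inj (quadratic_emb \<theta>)"
proof (rule injI)
  fix z z' assume "quadratic_emb \<theta> z = quadratic_emb \<theta> z'"
  then have "quadratic_emb \<theta> (z - z') = 0" by (simp flip: quadratic_emb_diff)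
  then show "z = z'" by (simp add: quadratic_emb_eq_0_iff[OF assms] prod_eq_iff)
qed

lemma quadratic_emb_bound:
  assumes "z \<in> int_pair_box C"
  shows "\<bar>quadratic_emb \<theta> z\<bar> \<le> C * (1 + \<bar>\<theta>\<bar>)"
proof -
  have "\<bar>quadratic_emb \<theta> z\<bar> \<le> \<bar>real_of_int (fst z)\<bar> + \<bar>real_of_int (snd z)\<bar> * \<bar>\<theta>\<bar>"
    unfolding quadratic_emb_def by (metis abs_mult abs_triangle_ineq)
  also have "\<dots> \<le> C + C * \<bar>\<theta>\<bar>"
    using assms by (intro add_mono mult_right_mono) (auto simp: int_pair_box_def)
  finally show ?thesis by (simp add: algebra_simps)
qed

text \<open>A primitive element of norm \<open>d\<close> distinguishes a root modulo \<open>d\<close> of the minimal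
  polynomial.\<close>

definition is_norm_root :: "int \<Rightarrow> int \<times> int \<Rightarrow> int \<Rightarrow> bool" where
  "is_norm_root d z r \<longleftrightarrow> d dvd fst z + snd z * r"

text \<open>The root is \<open>- x / y\<close> modulo \<open>d\<close>. The inverse of
  \<open>y\<close> exists because a common divisor of \<open>y\<close> and \<open>d\<close> divides
  \<open>x\<^sup>2\<close>, which is coprime to \<open>y\<close>.\<close>

lemma norm_root_exists:
  assumes cop: "coprime (fst z) (snd z)" and d: "d = quadratic_norm t n z" "d \<noteq> 0"
  shows "\<exists>r\<in>quadratic_roots_mod t n \<bar>d\<bar>. is_norm_root d z r"
proof -
  define x y where "x = fst z" and "y = snd z"
  have N: "d = x\<^sup>2 + t * x * y + n * y\<^sup>2" using d by (simp add: quadratic_norm_def x_def y_def)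
  have "coprime y d"
  proof (rule coprimeI)
    fix c assume c: "c dvd y" "c dvd d"
    have "x\<^sup>2 = d - y * (t * x + n * y)" unfolding N by (simp add: algebra_simps power2_eq_square)
    then have "c dvd x\<^sup>2" using c by simp
    moreover have "coprime (x\<^sup>2) y" using cop by (simp add: x_def y_def)
    ultimately show "c dvd 1" using c(1) by (meson coprime_common_divisor dvd_trans dvd_refl)
  qed
  then obtain u v where uv: "u * y + v * d = 1"
    using bezout_int[of y d] by (auto simp: coprime_iff_gcd_eq_1)
  define r where "r = (- x * u) mod \<bar>d\<bar>"
  have "d dvd r - (- x * u)" unfolding r_def by (metis abs_dvd_iff mod_eq_dvd_iff mod_mod_trivial)
  then obtain w where w: "r = - x * u + d * w" by (metis add.commute diff_add_cancel dvdE)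
  have "x + y * r = x * (1 - u * y) + d * (w * y)" unfolding w by (simp add: algebra_simps)
  also have "\<dots> = d * (x * v + w * y)" using uv by (metis add_diff_cancel_left' mult.commute mult.left_commute ring_class.ring_distribs(1))
  finally have xr: "d dvd x + y * r" by simp
  \<comment> \<open>Substituting \<open>x = - y * r\<close> into the norm form gives
    \<open>y\<^sup>2\<close> times the polynomial at \<open>r\<close>; the identity records the
    error as a multiple of \<open>x + y * r\<close>.\<close>
  have "y\<^sup>2 * (r\<^sup>2 - t * r + n) = d + (x + y * r) * (y * r - x - t * y)"
    unfolding N by (simp add: algebra_simps power2_eq_square)
  then have "d dvd y\<^sup>2 * (r\<^sup>2 - t * r + n)" using xr by simp
  then have "d dvd r\<^sup>2 - t * r + n"
    using \<open>coprime y d\<close> by (metis coprime_commute coprime_dvd_mult_right_iff coprime_power_right_iff)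
  then have "r \<in> quadratic_roots_mod t n \<bar>d\<bar>"
    using d(2) by (simp add: quadratic_roots_mod_def r_def)
  moreover have "is_norm_root d z r" using xr by (simp add: is_norm_root_def x_def y_def)
  ultimately show ?thesis by blast
qed


text \<open>A root is only available for coprime coordinates, hence this rational integer factor has
  to be split off first. For \<open>(0, 0)\<close> the content is 0 and division by 0 makes the
  primitive part \<open>(0, 0)\<close>.\<close>

definition pair_content :: "int \<times> int \<Rightarrow> int" where
  "pair_content z = gcd (fst z) (snd z)"

definition pair_primitive :: "int \<times> int \<Rightarrow> int \<times> int" where
  "pair_primitive z = (fst z div pair_content z, snd z div pair_content z)"

lemma pair_content_mult_primitive:
  "fst z = pair_content z * fst (pair_primitive z)" "snd z = pair_content z * snd (pair_primitive z)"
  by (simp_all add: pair_content_def pair_primitive_def)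

lemma coprime_pair_primitive:
  assumes "z \<noteq> (0, 0)"
  shows "coprime (fst (pair_primitive z)) (snd (pair_primitive z))"
  using assms by (auto simp: pair_content_def pair_primitive_def prod_eq_iff intro!: div_gcd_coprime)

lemma quadratic_norm_pair_primitive:
  "quadratic_norm t n z = (pair_content z)\<^sup>2 * quadratic_norm t n (pair_primitive z)"
proof -
  let ?c = "pair_content z" and ?x = "fst (pair_primitive z)" and ?y = "snd (pair_primitive z)"
  have "quadratic_norm t n z = (?c * ?x)\<^sup>2 + t * (?c * ?x) * (?c * ?y) + n * (?c * ?y)\<^sup>2"
    by (simp only: quadratic_norm_def pair_content_mult_primitive[symmetric])
  also have "\<dots> = ?c\<^sup>2 * quadratic_norm t n (pair_primitive z)"
    unfolding quadratic_norm_def by algebra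
  finally show ?thesis .
qed

lemma quadratic_emb_pair_primitive:
  "quadratic_emb \<theta> z = of_int (pair_content z) * quadratic_emb \<theta> (pair_primitive z)"
proof -
  let ?c = "pair_content z" and ?x = "fst (pair_primitive z)" and ?y = "snd (pair_primitive z)"
  have "quadratic_emb \<theta> z = of_int (?c * ?x) + of_int (?c * ?y) * \<theta>"
    by (simp only: quadratic_emb_def pair_content_mult_primitive[symmetric])
  also have "\<dots> = of_int ?c * quadratic_emb \<theta> (pair_primitive z)"
    unfolding quadratic_emb_def by (simp add: algebra_simps)
  finally show ?thesis .
qed

text \<open>For two elements of norm \<open>d\<close> belonging to the same root, the product of the first with the
  conjugate of the second is divisible by \<open>d\<close>, so that their ratio is a unit.\<close>

lemma norm_root_ratio:
  fixes t n d r :: int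
  assumes r: "d dvd r\<^sup>2 - t * r + n" and a: "is_norm_root d a r" and b: "is_norm_root d b r"
  obtains v where
    "fst a * fst b + t * fst a * snd b + n * snd a * snd b = d * fst v"
    "snd a * fst b - fst a * snd b = d * snd v"
proof -
  obtain p q k where pqk: "fst a + snd a * r = d * p" "fst b + snd b * r = d * q"
    "r\<^sup>2 - t * r + n = d * k"
    using assms by (auto simp: is_norm_root_def dvd_def)
  then have x: "fst a = d * p - snd a * r" "fst b = d * q - snd b * r" by simp_all
  \<comment> \<open>Modulo \<open>d\<close> the two elements are
    \<open>snd a * (\<theta> - r)\<close> and \<open>snd b * (\<theta> - r)\<close>. The first times
    the conjugate of the second is therefore \<open>snd a * snd b\<close> times the polynomial at
    \<open>r\<close>, hence 0.\<close>
  have "fst a * fst b + t * fst a * snd b + n * snd a * snd b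
      = snd a * snd b * (r\<^sup>2 - t * r + n)
        + d * (p * fst b - snd a * r * q + t * p * snd b)"
    unfolding x by (simp add: algebra_simps power2_eq_square)
  also have "\<dots> = d * (snd a * snd b * k + (p * fst b - snd a * r * q + t * p * snd b))"
    unfolding pqk by (simp add: algebra_simps)
  finally have 1: "fst a * fst b + t * fst a * snd b + n * snd a * snd b = \<dots>" .
  have "snd a * fst b - fst a * snd b = d * (snd a * q - p * snd b)"
    unfolding x by (simp add: algebra_simps)
  then show ?thesis
    using that[of "(snd a * snd b * k + (p * fst b - snd a * r * q + t * p * snd b),
      snd a * q - p * snd b)"] 1 by simp
qed

context real_quadratic
begin

lemma conj_real_quadratic: "real_quadratic t n \<theta>' \<theta>"
  using trace norm_eq conj_irrational by unfold_locales (simp_all add: add.commute mult.commute)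

lemma norm_eq_0_iff: "quadratic_norm t n z = 0 \<longleftrightarrow> z = (0, 0)"
  using norm_eq_mult[of z] quadratic_emb_eq_0_iff[OF irrational] quadratic_emb_eq_0_iff[OF conj_irrational]
  by (metis mult_eq_0_iff of_int_0_eq_iff)

text \<open>The first two assumptions give the coordinates of \<open>a\<close> times the conjugate
  of \<open>b\<close>. Since \<open>b\<close> times its conjugate is \<open>d\<close>, the conjugate
  of \<open>b\<close> cancels.\<close>

lemma emb_ratio:
  assumes "fst a * fst b + t * fst a * snd b + n * snd a * snd b = d * fst v"
    "snd a * fst b - fst a * snd b = d * snd v" "quadratic_norm t n b = d" "d \<noteq> 0"
  shows "quadratic_emb \<theta> a = quadratic_emb \<theta> v * quadratic_emb \<theta> b"
proof -
  have "quadratic_emb \<theta> a * quadratic_emb \<theta>' b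
    = of_int (fst a * fst b + t * fst a * snd b + n * snd a * snd b)
      + of_int (snd a * fst b - fst a * snd b) * \<theta>"
    by (simp add: quadratic_emb_def algebra_simps flip: trace norm_eq)
  also have "\<dots> = of_int d * quadratic_emb \<theta> v"
    unfolding assms(1,2) by (simp add: quadratic_emb_def algebra_simps)
  also have "\<dots> = (quadratic_emb \<theta> v * quadratic_emb \<theta> b) * quadratic_emb \<theta>' b"
    using norm_eq_mult[of b] assms(3) by (simp add: mult_ac)
  finally show ?thesis
    using norm_eq_mult[of b] assms(3,4) by auto
qed

text \<open>If both embeddings of \<open>v\<close> are at most \<open>e\<close> in absolute value,
  their difference \<open>snd v * (\<theta> - \<theta>')\<close> bounds \<open>snd v\<close> by
  \<open>q = 2 * e / \<bar>\<theta> - \<theta>'\<bar>\<close>, and then \<open>fst v\<close> is at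
  most \<open>e + q * \<bar>\<theta>\<bar>\<close>. The radius
  \<open>e + q * (1 + \<bar>\<theta>\<bar>)\<close> exceeds both bounds.\<close>

definition unit_box :: "(int \<times> int) set" where
  "unit_box = int_pair_box (exp 1 + 2 * exp 1 / \<bar>\<theta> - \<theta>'\<bar> * (1 + \<bar>\<theta>\<bar>))"

lemma in_unit_box:
  assumes "\<bar>quadratic_emb \<theta> v\<bar> \<le> exp 1" "\<bar>quadratic_emb \<theta>' v\<bar> \<le> exp 1"
  shows "v \<in> unit_box"
proof -
  define q where "q = 2 * exp 1 / \<bar>\<theta> - \<theta>'\<bar>"
  have "quadratic_emb \<theta> v - quadratic_emb \<theta>' v = of_int (snd v) * (\<theta> - \<theta>')"
    by (simp add: quadratic_emb_def algebra_simps)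
  then have "\<bar>of_int (snd v)\<bar> * \<bar>\<theta> - \<theta>'\<bar> \<le> 2 * exp 1"
    using assms by (simp flip: abs_mult)
  then have snd: "\<bar>of_int (snd v)\<bar> \<le> q"
    using conj_neq by (simp add: q_def field_simps)
  have "of_int (fst v) = quadratic_emb \<theta> v - of_int (snd v) * \<theta>"
    by (simp add: quadratic_emb_def)
  then have "\<bar>of_int (fst v)\<bar> \<le> \<bar>quadratic_emb \<theta> v\<bar> + \<bar>of_int (snd v)\<bar> * \<bar>\<theta>\<bar>"
    by (metis abs_mult abs_triangle_ineq4)
  also have "\<dots> \<le> exp 1 + q * \<bar>\<theta>\<bar>"
    using assms snd by (intro add_mono mult_right_mono) auto
  finally have fst: "\<bar>of_int (fst v)\<bar> \<le> exp 1 + q * \<bar>\<theta>\<bar>" .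
  have "q \<ge> 0" "exp (1::real) > 0" "q * \<bar>\<theta>\<bar> \<ge> 0" by (simp_all add: q_def)
  with fst snd show ?thesis
    unfolding unit_box_def int_pair_box_def q_def[symmetric] by (simp add: algebra_simps)
qed

text \<open>Two elements in the same logarithmic window differ by a unit of absolute value between
  \<open>1 / e\<close> and \<open>e\<close> in both embeddings; there are only finitely many of these.\<close>

lemma card_same_class_le:
  assumes F: "\<And>z. z \<in> F \<Longrightarrow> pair_content z = g \<and> quadratic_norm t n (pair_primitive z) = d
      \<and> is_norm_root d (pair_primitive z) r \<and> \<lfloor>ln \<bar>quadratic_emb \<theta> z\<bar>\<rfloor> = j"
    and d: "d \<noteq> 0" "g \<noteq> 0" and r: "d dvd r\<^sup>2 - t * r + n"
  shows "card F \<le> card unit_box"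
proof (cases "F = {}")
  case False
  then obtain b where b: "b \<in> F" by blast
  have "\<exists>v\<in>unit_box. quadratic_emb \<theta> a = quadratic_emb \<theta> v * quadratic_emb \<theta> b" if a: "a \<in> F" for a
  proof -
    interpret conj: real_quadratic t n \<theta>' \<theta> by (rule conj_real_quadratic)
    \<comment> \<open>The coordinates of the ratio are integers that do not involve the choice of
      embedding, so one \<open>v\<close> serves both.\<close>
    obtain v where v:
      "quadratic_emb \<theta> (pair_primitive a) = quadratic_emb \<theta> v * quadratic_emb \<theta> (pair_primitive b)"
      "quadratic_emb \<theta>' (pair_primitive a) = quadratic_emb \<theta>' v * quadratic_emb \<theta>' (pair_primitive b)"
      using norm_root_ratio[OF r, of "pair_primitive a" "pair_primitive b"] F[OF a] F[OF b] d(1)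
        emb_ratio conj.emb_ratio by metis
    then have ab: "quadratic_emb \<theta> a = quadratic_emb \<theta> v * quadratic_emb \<theta> b"
      using F[OF a] F[OF b]
      by (simp add: quadratic_emb_pair_primitive[of _ a] quadratic_emb_pair_primitive[of _ b])
    have nz: "quadratic_emb \<theta> a \<noteq> 0" "quadratic_emb \<theta> b \<noteq> 0" "quadratic_emb \<theta> v \<noteq> 0"
      using F[OF a] F[OF b] d norm_eq_mult[of "pair_primitive a"] norm_eq_mult[of "pair_primitive b"] v
      by (auto simp: quadratic_emb_pair_primitive[of _ a] quadratic_emb_pair_primitive[of _ b])
    have ln_eq: "ln \<bar>quadratic_emb \<theta> a\<bar> = ln \<bar>quadratic_emb \<theta> v\<bar> + ln \<bar>quadratic_emb \<theta> b\<bar>"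
      using nz by (simp add: ab abs_mult ln_mult)
    have "\<bar>ln \<bar>quadratic_emb \<theta> a\<bar> - ln \<bar>quadratic_emb \<theta> b\<bar>\<bar> < 1"
      using F[OF a] F[OF b] by linarith
    then have lnv: "\<bar>ln \<bar>quadratic_emb \<theta> v\<bar>\<bar> < 1" using ln_eq by simp
    then have 1: "\<bar>quadratic_emb \<theta> v\<bar> \<le> exp 1"
      using nz by (metis abs_less_iff exp_le_cancel_iff exp_ln less_imp_le zero_less_abs_iff)
    \<comment> \<open>Equal norms make \<open>v\<close> a unit of norm 1, so a two-sided bound on
      the logarithm in one embedding gives the same bound in the other.\<close>
    have "of_int d = quadratic_emb \<theta> v * quadratic_emb \<theta>' v * of_int d"
      using norm_eq_mult[of "pair_primitive a"] norm_eq_mult[of "pair_primitive b"] F[OF a] F[OF b] v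
      by (simp add: mult_ac)
    then have "quadratic_emb \<theta> v * quadratic_emb \<theta>' v = 1" using d by simp
    then have "\<bar>quadratic_emb \<theta>' v\<bar> = exp (- ln \<bar>quadratic_emb \<theta> v\<bar>)"
      using nz by (simp add: exp_minus field_simps flip: abs_mult)
    then have "\<bar>quadratic_emb \<theta>' v\<bar> \<le> exp 1" using lnv by simp
    with 1 ab in_unit_box show ?thesis by blast
  qed
  then have "quadratic_emb \<theta> ` F \<subseteq> (\<lambda>v. quadratic_emb \<theta> v * quadratic_emb \<theta> b) ` unit_box"
    by blast
  then have "card (quadratic_emb \<theta> ` F) \<le> card unit_box"
    by (intro surj_card_le) (simp_all add: unit_box_def)
  then show ?thesis
    using inj_quadratic_emb[OF irrational] by (metis card_image inj_on_subset subset_UNIV)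
qed simp

end


lemma card_int_divisors_le:
  fixes m :: int
  assumes "m \<noteq> 0"
  shows "finite {d. d dvd m}" "card {d. d dvd m} \<le> 2 * card {e. e dvd nat \<bar>m\<bar>}"
proof -
  let ?D = "{e. e dvd nat \<bar>m\<bar>}"
  have fin: "finite ?D" using assms by (intro finite_divisors_nat) simp
  have sub: "{d. d dvd m} \<subseteq> int ` ?D \<union> (\<lambda>e. - int e) ` ?D"
  proof
    fix d assume "d \<in> {d. d dvd m}"
    then have "nat \<bar>d\<bar> \<in> ?D" by (simp add: nat_abs_dvd_iff)
    then show "d \<in> int ` ?D \<union> (\<lambda>e. - int e) ` ?D"
      by (cases "d \<ge> 0") (auto intro!: image_eqI[where x = "nat \<bar>d\<bar>"])
  qed
  then show "finite {d. d dvd m}" by (rule finite_subset) (use fin in simp)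
  have "card {d. d dvd m} \<le> card (int ` ?D \<union> (\<lambda>e. - int e) ` ?D)"
    using sub fin by (intro card_mono) auto
  also have "\<dots> \<le> card (int ` ?D) + card ((\<lambda>e. - int e) ` ?D)"
    by (rule card_Un_le)
  also have "\<dots> \<le> card ?D + card ?D"
    using fin by (intro add_mono card_image_le)
  finally show "card {d. d dvd m} \<le> 2 * card ?D" by simp
qed

context real_quadratic
begin

text \<open>The factors count, from left to right, the possible norms, contents, roots modulo the
  norm of the primitive part, logarithmic windows, and units within one window. The facts labelled
  4, 3 and 2 build this up from the inside.\<close>

lemma card_box_divisors_le:
  assumes C: "C \<ge> 1" and m0: "m0 \<noteq> 0"
  defines "\<tau> \<equiv> real (card {e. e dvd nat \<bar>m0\<bar>})"
    and "L \<equiv> ln C + ln (1 + \<bar>\<theta>\<bar>) + ln (1 + \<bar>\<theta>'\<bar>)"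
  shows "real (card {z \<in> int_pair_box C. quadratic_norm t n z \<noteq> 0 \<and> quadratic_norm t n z dvd m0})
    \<le> (2 * \<tau>) * (\<tau> * ((\<tau> * of_int \<bar>t\<^sup>2 - 4 * n\<bar>) * ((2 * L + 2) * real (card unit_box))))"
proof -
  define S where "S = {z \<in> int_pair_box C. quadratic_norm t n z \<noteq> 0 \<and> quadratic_norm t n z dvd m0}"
  have L0: "L \<ge> 0" using C by (simp add: L_def)
  have fin0: "finite {e. e dvd nat \<bar>m0\<bar>}" using m0 by (intro finite_divisors_nat) simp
  \<comment> \<open>The box bounds both embeddings from above. Their product has absolute value at
    least 1, being a nonzero integer, so each is also bounded from below.\<close>
  have S_ln: "\<bar>ln \<bar>quadratic_emb \<theta> z\<bar>\<bar> \<le> L" if "z \<in> S" for z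
  proof -
    have z: "z \<in> int_pair_box C" and N: "quadratic_norm t n z \<noteq> 0" using that by (auto simp: S_def)
    have nz: "quadratic_emb \<theta> z \<noteq> 0" "quadratic_emb \<theta>' z \<noteq> 0"
      using N norm_eq_mult[of z] by auto
    have "1 \<le> \<bar>of_int (quadratic_norm t n z) :: real\<bar>" using N by linarith
    then have "0 \<le> ln (\<bar>quadratic_emb \<theta> z\<bar> * \<bar>quadratic_emb \<theta>' z\<bar>)"
      unfolding norm_eq_mult by (simp add: abs_mult)
    then have "0 \<le> ln \<bar>quadratic_emb \<theta> z\<bar> + ln \<bar>quadratic_emb \<theta>' z\<bar>"
      using nz by (simp add: ln_mult)
    moreover have "ln \<bar>quadratic_emb \<theta> z\<bar> \<le> ln (C * (1 + \<bar>\<theta>\<bar>))"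
      using quadratic_emb_bound[OF z] nz by (intro ln_mono) auto
    moreover have "ln \<bar>quadratic_emb \<theta>' z\<bar> \<le> ln (C * (1 + \<bar>\<theta>'\<bar>))"
      using quadratic_emb_bound[OF z] nz by (intro ln_mono) auto
    moreover have "ln (C * (1 + \<bar>\<theta>\<bar>)) = ln C + ln (1 + \<bar>\<theta>\<bar>)" "ln (C * (1 + \<bar>\<theta>'\<bar>)) = ln C + ln (1 + \<bar>\<theta>'\<bar>)"
      using C by (simp_all add: ln_mult)
    moreover have "ln (1 + \<bar>\<theta>\<bar>) \<ge> 0" "ln (1 + \<bar>\<theta>'\<bar>) \<ge> 0" by simp_all
    ultimately show ?thesis unfolding L_def by linarith
  qed
  have 4: "real (card F) \<le> (2 * L + 2) * real (card unit_box)"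
    if F: "F \<subseteq> S" "\<And>z. z \<in> F \<Longrightarrow> pair_content z = g \<and> quadratic_norm t n (pair_primitive z) = d
      \<and> is_norm_root d (pair_primitive z) r" "d \<noteq> 0" "g \<noteq> 0" "d dvd r\<^sup>2 - t * r + n" for F g d r
  proof -
    let ?f = "\<lambda>z. \<lfloor>ln \<bar>quadratic_emb \<theta> z\<bar>\<rfloor>"
    have "real (card F) \<le> real (card {\<lfloor>- L\<rfloor>..\<lfloor>L\<rfloor>}) * real (card unit_box)"
    proof (rule card_le_of_fibers[of _ ?f])
      show "?f ` F \<subseteq> {\<lfloor>- L\<rfloor>..\<lfloor>L\<rfloor>}"
      proof
        fix y assume "y \<in> ?f ` F"
        then obtain z where z: "z \<in> S" "y = ?f z" using F(1) by blast
        then show "y \<in> {\<lfloor>- L\<rfloor>..\<lfloor>L\<rfloor>}"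
          using S_ln[OF z(1)] by (auto intro!: floor_mono)
      qed
      fix j
      show "real (card {z \<in> F. ?f z = j}) \<le> real (card unit_box)"
        unfolding of_nat_le_iff using F(2-) by (intro card_same_class_le[of _ g d r j]) auto
    qed simp
    also have "real (card {\<lfloor>- L\<rfloor>..\<lfloor>L\<rfloor>}) \<le> 2 * L + 2"
      using L0 by (simp, linarith)
    finally show ?thesis by (simp add: mult_right_mono)
  qed
  have 3: "real (card F) \<le> (\<tau> * of_int \<bar>t\<^sup>2 - 4 * n\<bar>) * ((2 * L + 2) * real (card unit_box))"
    if F: "F \<subseteq> S" "\<And>z. z \<in> F \<Longrightarrow> nat (pair_content z) = g \<and> quadratic_norm t n z = m" for F g m
  proof (cases "F = {}")
    case False
    then obtain b where b: "b \<in> F" by blast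
    define d where "d = quadratic_norm t n (pair_primitive b)"
    have N: "quadratic_norm t n b \<noteq> 0" "quadratic_norm t n b dvd m0"
      using b F(1) by (auto simp: S_def)
    have d: "d \<noteq> 0" "d dvd m0"
      using N unfolding quadratic_norm_pair_primitive[of t n b] d_def by (auto dest: dvd_mult_right)
    have g: "pair_content z = int g" if "z \<in> F" for z
      using F(2)[OF that] by (auto simp: pair_content_def)
    have g0: "g \<noteq> 0" using N(1) g[OF b] by (auto simp: quadratic_norm_pair_primitive[of t n b])
    \<comment> \<open>The norm is the square of the content times the norm of the primitive part, so
      fixing the first two fixes the third.\<close>
    have dz: "quadratic_norm t n (pair_primitive z) = d" if "z \<in> F" for z
      using F(2)[OF that] F(2)[OF b] g[OF that] g[OF b] g0
      unfolding quadratic_norm_pair_primitive[of t n z] quadratic_norm_pair_primitive[of t n b] d_def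
      by (metis mult_cancel_left of_nat_eq_0_iff power_eq_0_iff)
    define f where "f z = (SOME r. r \<in> quadratic_roots_mod t n \<bar>d\<bar> \<and> is_norm_root d (pair_primitive z) r)" for z
    have f: "f z \<in> quadratic_roots_mod t n \<bar>d\<bar> \<and> is_norm_root d (pair_primitive z) (f z)" if "z \<in> F" for z
    proof -
      have "z \<noteq> (0, 0)" using F(1) that norm_eq_0_iff by (auto simp: S_def)
      then have "\<exists>r. r \<in> quadratic_roots_mod t n \<bar>d\<bar> \<and> is_norm_root d (pair_primitive z) r"
        using norm_root_exists[OF coprime_pair_primitive] dz[OF that] d(1) by blast
      then show ?thesis unfolding f_def by (rule someI_ex)
    qed
    have "real (card F) \<le> real (card (quadratic_roots_mod t n \<bar>d\<bar>)) * ((2 * L + 2) * real (card unit_box))"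
    proof (rule card_le_of_fibers[of _ f])
      show "f ` F \<subseteq> quadratic_roots_mod t n \<bar>d\<bar>" using f by blast
      fix r assume "r \<in> quadratic_roots_mod t n \<bar>d\<bar>"
      then have "d dvd r\<^sup>2 - t * r + n" by (simp add: quadratic_roots_mod_def)
      then show "real (card {z \<in> F. f z = r}) \<le> (2 * L + 2) * real (card unit_box)"
        using F(1) f g dz d(1) g0 by (intro 4[of _ "int g" d r]) auto
    qed simp
    also have "real (card (quadratic_roots_mod t n \<bar>d\<bar>)) \<le> \<tau> * of_int \<bar>t\<^sup>2 - 4 * n\<bar>"
    proof -
      have "{e. e dvd nat \<bar>d\<bar>} \<subseteq> {e. e dvd nat \<bar>m0\<bar>}"
        using d(2) by (auto simp: nat_dvd_iff intro: dvd_trans)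
      then have "card {e. e dvd nat \<bar>d\<bar>} \<le> card {e. e dvd nat \<bar>m0\<bar>}"
        using fin0 by (rule card_mono[rotated])
      then have "real (card {e. e dvd nat \<bar>d\<bar>}) * of_int \<bar>t\<^sup>2 - 4 * n\<bar> \<le> \<tau> * of_int \<bar>t\<^sup>2 - 4 * n\<bar>"
        unfolding \<tau>_def by (intro mult_right_mono) auto
      then show ?thesis
        using card_quadratic_roots_mod_le[of "\<bar>d\<bar>" t n] d(1) disc_neq_0 by linarith
    qed
    finally show ?thesis using L0 by (simp add: mult_right_mono)
  qed (use L0 in \<open>simp add: \<tau>_def\<close>)
  have 2: "real (card F) \<le> \<tau> * ((\<tau> * of_int \<bar>t\<^sup>2 - 4 * n\<bar>) * ((2 * L + 2) * real (card unit_box)))"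
    if F: "F \<subseteq> S" "\<And>z. z \<in> F \<Longrightarrow> quadratic_norm t n z = m" for F m
  proof -
    have "real (card F) \<le> real (card {e. e dvd nat \<bar>m0\<bar>})
        * ((\<tau> * of_int \<bar>t\<^sup>2 - 4 * n\<bar>) * ((2 * L + 2) * real (card unit_box)))"
    proof (rule card_le_of_fibers[of _ "\<lambda>z. nat (pair_content z)"])
    show "(\<lambda>z. nat (pair_content z)) ` F \<subseteq> {e. e dvd nat \<bar>m0\<bar>}"
    proof
      fix e assume "e \<in> (\<lambda>z. nat (pair_content z)) ` F"
      then obtain z where z: "z \<in> S" "e = nat (pair_content z)" using F(1) by blast
      then have "pair_content z dvd m0"
        using dvd_trans[of "pair_content z" "quadratic_norm t n z" m0]
        by (auto simp: S_def quadratic_norm_pair_primitive[of t n z] power2_eq_square)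
      then show "e \<in> {e. e dvd nat \<bar>m0\<bar>}"
        using z(2) by (simp add: pair_content_def nat_dvd_iff)
    qed
    show "real (card {z \<in> F. nat (pair_content z) = g})
      \<le> (\<tau> * of_int \<bar>t\<^sup>2 - 4 * n\<bar>) * ((2 * L + 2) * real (card unit_box))" for g
      using F by (intro 3[of _ g m]) auto
    qed (use fin0 in auto)
    then show ?thesis by (simp only: \<tau>_def)
  qed
  have "real (card S) \<le> real (card {d. d dvd m0})
      * (\<tau> * ((\<tau> * of_int \<bar>t\<^sup>2 - 4 * n\<bar>) * ((2 * L + 2) * real (card unit_box))))"
  proof (rule card_le_of_fibers[of _ "quadratic_norm t n"])
    show "real (card {z \<in> S. quadratic_norm t n z = m}) \<le> \<tau> * ((\<tau> * of_int \<bar>t\<^sup>2 - 4 * n\<bar>) * ((2 * L + 2) * real (card unit_box)))" for m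
      by (rule 2) auto
  qed (use card_int_divisors_le[OF m0] in \<open>auto simp: S_def\<close>)
  also have "real (card {d. d dvd m0}) \<le> 2 * \<tau>"
    using card_int_divisors_le(2)[OF m0] unfolding \<tau>_def by linarith
  finally show ?thesis
    unfolding S_def using L0 by (simp add: mult_right_mono \<tau>_def)
qed

end


section \<open>Factorizations of a fixed element and separation of products\<close>

definition quadratic_mult :: "int \<Rightarrow> int \<Rightarrow> int \<times> int \<Rightarrow> int \<times> int \<Rightarrow> int \<times> int" where
  "quadratic_mult t n z w = (fst z * fst w - n * snd z * snd w,
     fst z * snd w + snd z * fst w + t * snd z * snd w)"

lemma (in real_quadratic) emb_mult:
  "quadratic_emb \<theta> (quadratic_mult t n z w) = quadratic_emb \<theta> z * quadratic_emb \<theta> w"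
  by (simp add: quadratic_mult_def quadratic_emb_def algebra_simps flip: trace norm_eq)

lemma (in real_quadratic) norm_mult:
  "quadratic_norm t n (quadratic_mult t n z w) = quadratic_norm t n z * quadratic_norm t n w"
  unfolding quadratic_norm_def quadratic_mult_def fst_conv snd_conv by algebra

lemma (in real_quadratic) norm_bound:
  assumes "z \<in> int_pair_box C"
  shows "\<bar>of_int (quadratic_norm t n z)\<bar> \<le> C\<^sup>2 * ((1 + \<bar>\<theta>\<bar>) * (1 + \<bar>\<theta>'\<bar>))"
proof -
  have "\<bar>of_int (quadratic_norm t n z)\<bar> = \<bar>quadratic_emb \<theta> z\<bar> * \<bar>quadratic_emb \<theta>' z\<bar>"
    by (simp add: norm_eq_mult abs_mult)
  also have "\<dots> \<le> (C * (1 + \<bar>\<theta>\<bar>)) * (C * (1 + \<bar>\<theta>'\<bar>))"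
    using quadratic_emb_bound[OF assms] by (intro mult_mono) (auto intro: order_trans[OF abs_ge_zero])
  finally show ?thesis by (simp add: power2_eq_square mult_ac)
qed

text \<open>The first factor determines the second, and its norm divides the norm of the product, a
  nonzero integer of size \<open>O(C ^ 4)\<close>; hence \<open>card_box_divisors_le\<close> and the
  divisor bound apply.\<close>

lemma (in real_quadratic) card_factorizations_le:
  fixes \<eta> :: real
  assumes \<eta>: "\<eta> > 0"
  shows "\<exists>K>0. \<forall>C\<ge>1. \<forall>M. M \<noteq> 0 \<longrightarrow>
    real (card {(z, w). z \<in> int_pair_box C \<and> w \<in> int_pair_box C
      \<and> quadratic_emb \<theta> z * quadratic_emb \<theta> w = M}) \<le> K * C powr \<eta>"
proof -
  interpret conj: real_quadratic t n \<theta>' \<theta> by (rule conj_real_quadratic)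
  \<comment> \<open>Since the norm of the product is \<open>O(C ^ 4)\<close>, the exponent
    \<open>\<eta> / 16\<close> bounds its number of divisors by \<open>C powr (\<eta> / 4)\<close>
    up to a constant. This number enters three times and a logarithm of \<open>C\<close> once, four
    factors \<open>C powr (\<eta> / 4)\<close> in all.\<close>
  obtain K where K: "K > 0" "\<And>m::nat. m > 0 \<Longrightarrow> real (card {d. d dvd m}) \<le> K * real m powr (\<eta> / 16)"
    using card_divisors_powr_bound[of "\<eta> / 16"] \<eta> by auto
  define B where "B = (1 + \<bar>\<theta>\<bar>) * (1 + \<bar>\<theta>'\<bar>)"
  define D where "D = real_of_int \<bar>t\<^sup>2 - 4 * n\<bar>"
  define l where "l = ln (1 + \<bar>\<theta>\<bar>) + ln (1 + \<bar>\<theta>'\<bar>)"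
  define U where "U = real (card unit_box)"
  define J where "J = K * (B\<^sup>2) powr (\<eta> / 16)"
  define K' where "K' = 2 * J ^ 3 * D * (2 * (4 / \<eta> + l) + 2) * U"
  have B: "B \<ge> 1" unfolding B_def by (metis abs_ge_zero le_add_same_cancel1 mult_ge1_I)
  have pos: "D \<ge> 0" "l \<ge> 0" "U \<ge> 0" by (simp_all add: D_def l_def U_def)
  have J: "J > 0" using K(1) B by (simp add: J_def)
  have K': "K' \<ge> 0" using pos J \<eta> by (simp add: K'_def)
  have "real (card {(z, w). z \<in> int_pair_box C \<and> w \<in> int_pair_box C
      \<and> quadratic_emb \<theta> z * quadratic_emb \<theta> w = M}) \<le> K' * C powr \<eta>"
    if C: "C \<ge> 1" and M: "M \<noteq> 0" for C M
  proof -
    define S where "S = {(z, w). z \<in> int_pair_box C \<and> w \<in> int_pair_box C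
      \<and> quadratic_emb \<theta> z * quadratic_emb \<theta> w = M}"
    show ?thesis
    proof (cases "S = {}")
      case True
      then show ?thesis using K' by (simp only: S_def[symmetric] card.empty) simp
    next
      case False
      then obtain z0 w0 where zw0: "(z0, w0) \<in> S" by auto
      \<comment> \<open>\<open>M\<close> is only a real number, so its norm is read off from one
        factorization; injectivity of the embedding shows that all others give the same
        value.\<close>
      define m0 where "m0 = quadratic_norm t n z0 * quadratic_norm t n w0"
      have m: "quadratic_norm t n z * quadratic_norm t n w = m0" if "(z, w) \<in> S" for z w
      proof -
        have "quadratic_emb \<theta> (quadratic_mult t n z w) = quadratic_emb \<theta> (quadratic_mult t n z0 w0)"
          using that zw0 by (simp add: emb_mult S_def)
        then have "quadratic_mult t n z w = quadratic_mult t n z0 w0"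
          using inj_quadratic_emb[OF irrational] by (simp add: inj_eq)
        then show ?thesis unfolding m0_def by (simp flip: norm_mult)
      qed
      have nz: "z \<noteq> (0, 0)" "w \<noteq> (0, 0)" if "(z, w) \<in> S" for z w
        using that M by (auto simp: S_def quadratic_emb_def)
      have m0: "m0 \<noteq> 0"
        using nz[OF zw0] norm_eq_0_iff by (simp add: m0_def)
      have "inj_on fst S"
      proof (rule inj_onI)
        fix p q assume pq: "p \<in> S" "q \<in> S" "fst p = fst q"
        then have "quadratic_emb \<theta> (fst p) * quadratic_emb \<theta> (snd p)
            = quadratic_emb \<theta> (fst p) * quadratic_emb \<theta> (snd q)"
          by (auto simp: S_def)
        moreover have "quadratic_emb \<theta> (fst p) \<noteq> 0"
          using nz pq(1) by (metis prod.collapse quadratic_emb_eq_0_iff[OF irrational])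
        ultimately have "snd p = snd q"
          using inj_quadratic_emb[OF irrational] by (simp add: inj_eq)
        with pq(3) show "p = q" by (rule prod_eqI)
      qed
      moreover have "fst ` S \<subseteq> {z \<in> int_pair_box C. quadratic_norm t n z \<noteq> 0 \<and> quadratic_norm t n z dvd m0}"
      proof
        fix z assume "z \<in> fst ` S"
        then obtain w where zw: "(z, w) \<in> S" by auto
        then show "z \<in> {z \<in> int_pair_box C. quadratic_norm t n z \<noteq> 0 \<and> quadratic_norm t n z dvd m0}"
          using m[OF zw] nz[OF zw] norm_eq_0_iff by (auto simp: S_def)
      qed
      moreover have "finite {z \<in> int_pair_box C. quadratic_norm t n z \<noteq> 0 \<and> quadratic_norm t n z dvd m0}"
        by simp
      ultimately have "card S \<le> card {z \<in> int_pair_box C. quadratic_norm t n z \<noteq> 0 \<and> quadratic_norm t n z dvd m0}"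
        by (rule card_inj_on_le)
      also have "real \<dots> \<le> (2 * real (card {e. e dvd nat \<bar>m0\<bar>})) * (real (card {e. e dvd nat \<bar>m0\<bar>})
          * ((real (card {e. e dvd nat \<bar>m0\<bar>}) * D) * ((2 * (ln C + l) + 2) * U)))"
        using card_box_divisors_le[OF C m0] by (simp only: D_def l_def U_def add.assoc)
      also have "\<dots> = 2 * real (card {e. e dvd nat \<bar>m0\<bar>}) ^ 3 * D * (2 * (ln C + l) + 2) * U"
        by (simp add: power3_eq_cube)
      also have "\<dots> \<le> 2 * (J * C powr (\<eta> / 4)) ^ 3 * D * ((2 * (4 / \<eta> + l) + 2) * C powr (\<eta> / 4)) * U"
      proof -
        have "\<bar>real_of_int m0\<bar> \<le> (C\<^sup>2 * B) * (C\<^sup>2 * B)"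
          unfolding m0_def of_int_mult abs_mult B_def using zw0 B
          by (intro mult_mono norm_bound) (auto simp: S_def B_def[symmetric])
        also have "\<dots> = B\<^sup>2 * C powr 4"
          using C by (simp add: powr_numeral power2_eq_square power4_eq_xxxx)
        finally have "\<bar>real_of_int m0\<bar> powr (\<eta> / 16) \<le> (B\<^sup>2 * C powr 4) powr (\<eta> / 16)"
          using \<eta> by (intro powr_mono2) auto
        also have "\<dots> = (B\<^sup>2) powr (\<eta> / 16) * C powr (\<eta> / 4)"
          using B C by (subst powr_mult) (simp_all add: powr_powr del: powr_numeral)
        finally have *: "K * \<bar>real_of_int m0\<bar> powr (\<eta> / 16) \<le> J * C powr (\<eta> / 4)"
          using K(1) by (simp add: J_def)
        have "real (card {e. e dvd nat \<bar>m0\<bar>}) \<le> K * \<bar>real_of_int m0\<bar> powr (\<eta> / 16)"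
          using K(2)[of "nat \<bar>m0\<bar>"] m0 by simp
        with * have t: "real (card {e. e dvd nat \<bar>m0\<bar>}) \<le> J * C powr (\<eta> / 4)" by linarith
        have c1: "C powr (\<eta> / 4) \<ge> 1" using C \<eta> by (simp add: ge_one_powr_ge_zero)
        have "ln C \<le> C powr (\<eta> / 4) * (4 / \<eta>)"
          using ln_powr_bound[of C "\<eta> / 4"] C \<eta> by simp
        moreover have "l \<le> l * C powr (\<eta> / 4)" using c1 pos by (simp add: mult_le_cancel_left1)
        ultimately have L: "2 * (ln C + l) + 2 \<le> (2 * (4 / \<eta> + l) + 2) * C powr (\<eta> / 4)"
          using c1 by (simp add: algebra_simps)
        have "0 \<le> 2 * (ln C + l) + 2" using C pos by simp
        moreover have "0 \<le> 2 * (4 / \<eta> + l) + 2" using \<eta> pos by simp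
        ultimately show ?thesis
          using t L J pos by (intro mult_mono power_mono mult_nonneg_nonneg) auto
      qed
      also have "\<dots> = K' * (C powr (\<eta> / 4)) ^ 4"
        by (simp only: K'_def power_mult_distrib power3_eq_cube power4_eq_xxxx mult_ac)
      also have "\<dots> = K' * C powr \<eta>"
        using C by (simp add: powr_power)
      finally show ?thesis by (simp add: S_def)
    qed
  qed
  then have "\<forall>C\<ge>1. \<forall>M. M \<noteq> 0 \<longrightarrow>
    real (card {(z, w). z \<in> int_pair_box C \<and> w \<in> int_pair_box C
      \<and> quadratic_emb \<theta> z * quadratic_emb \<theta> w = M}) \<le> (K' + 1) * C powr \<eta>"
    by (meson K' add_increasing2 mult_right_mono order_trans powr_ge_zero order_refl zero_le_one)
  then show ?thesis using K' by (intro exI[of _ "K' + 1"]) auto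
qed

lemma (in real_quadratic) products_separated:
  assumes C: "C \<ge> 1"
    and box: "z \<in> int_pair_box C" "w \<in> int_pair_box C" "z' \<in> int_pair_box C" "w' \<in> int_pair_box C"
    and neq: "quadratic_emb \<theta> z * quadratic_emb \<theta> w \<noteq> quadratic_emb \<theta> z' * quadratic_emb \<theta> w'"
  shows "\<bar>quadratic_emb \<theta> z * quadratic_emb \<theta> w - quadratic_emb \<theta> z' * quadratic_emb \<theta> w'\<bar>
    \<ge> 1 / (2 * (1 + \<bar>\<theta>'\<bar>)\<^sup>2) / C\<^sup>2"
proof -
  interpret conj: real_quadratic t n \<theta>' \<theta> by (rule conj_real_quadratic)
  define v where "v = quadratic_mult t n z w - quadratic_mult t n z' w'"
  define H where "H = C * (1 + \<bar>\<theta>'\<bar>)"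
  have v: "quadratic_emb \<theta> v = quadratic_emb \<theta> z * quadratic_emb \<theta> w - quadratic_emb \<theta> z' * quadratic_emb \<theta> w'"
    "quadratic_emb \<theta>' v = quadratic_emb \<theta>' z * quadratic_emb \<theta>' w - quadratic_emb \<theta>' z' * quadratic_emb \<theta>' w'"
    by (simp_all add: v_def emb_mult conj.emb_mult flip: quadratic_emb_diff)
  have H: "H > 0" using C by (simp add: H_def add_pos_nonneg)
  have prod: "\<bar>quadratic_emb \<theta>' a * quadratic_emb \<theta>' b\<bar> \<le> H * H"
    if "a \<in> int_pair_box C" "b \<in> int_pair_box C" for a b
    unfolding abs_mult H_def using that H
    by (intro mult_mono quadratic_emb_bound) (auto simp: H_def)
  \<comment> \<open>An upper bound on the conjugate of the difference is what is needed: the norm is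
    a nonzero integer, so this bounds the difference itself from below.\<close>
  have "\<bar>quadratic_emb \<theta>' v\<bar> \<le> 2 * H\<^sup>2"
    using prod[OF box(1,2)] prod[OF box(3,4)] unfolding v power2_eq_square by linarith
  moreover have "1 \<le> \<bar>quadratic_emb \<theta> v\<bar> * \<bar>quadratic_emb \<theta>' v\<bar>"
  proof -
    have "quadratic_norm t n v \<noteq> 0"
      using neq v norm_eq_0_iff by (auto simp: quadratic_emb_def)
    then have "1 \<le> \<bar>real_of_int (quadratic_norm t n v)\<bar>" by linarith
    then show ?thesis by (simp add: norm_eq_mult abs_mult)
  qed
  ultimately have "1 \<le> \<bar>quadratic_emb \<theta> v\<bar> * (2 * H\<^sup>2)"
    by (meson abs_ge_zero mult_left_mono order_trans)
  then have "1 / (2 * H\<^sup>2) \<le> \<bar>quadratic_emb \<theta> v\<bar>"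
    using H by (simp add: field_simps)
  then show ?thesis by (simp add: v H_def power_mult_distrib mult_ac)
qed

section \<open>Passage from quadratic integers to quadratic irrationals\<close>

lemma quadratic_irrational_root:
  assumes "algebraic \<omega>" "alg_degree \<omega> = 2" "\<omega> \<notin> \<rat>"
  obtains a b c :: int where "a \<noteq> 0" "of_int a * \<omega>\<^sup>2 + of_int b * \<omega> + of_int c = 0"
proof -
  obtain p0 :: "real poly" where p0: "\<forall>i. coeff p0 i \<in> \<int>" "p0 \<noteq> 0" "poly p0 \<omega> = 0"
    using assms(1) by (auto simp: algebraic_def)
  \<comment> \<open>The \<open>LEAST\<close> in \<open>alg_degree\<close> is attained only if some
    polynomial qualifies; an annihilating polynomial with integer coefficients does.\<close>
  have "\<exists>m. \<exists>q :: real poly. (\<forall>i. coeff q i \<in> \<rat>) \<and> q \<noteq> 0 \<and> poly q \<omega> = 0 \<and> degree q = m"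
    using p0 Ints_subset_Rats by blast
  from LeastI_ex[OF this] obtain q :: "real poly"
    where q: "\<forall>i. coeff q i \<in> \<rat>" "poly q \<omega> = 0" "degree q = 2"
    using assms(2) unfolding alg_degree_def by metis
  have "\<exists>(m::int) k::int. k \<noteq> 0 \<and> coeff q i = of_int m / of_int k" for i
    using q(1) by (metis Rats_cases' less_irrefl of_int_0_less_iff)
  then obtain m k :: "nat \<Rightarrow> int" where mk: "\<And>i. k i \<noteq> 0" "\<And>i. coeff q i = of_int (m i) / of_int (k i)"
    by metis
  have "coeff q 2 \<noteq> 0" using q(3) by (metis leading_coeff_0_iff degree_0 zero_neq_numeral)
  then have m2: "m 2 \<noteq> 0" using mk(2)[of 2] by auto
  have "coeff q 0 + coeff q 1 * \<omega> + coeff q 2 * \<omega>\<^sup>2 = 0"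
    using q(2,3) by (simp add: poly_altdef numeral_2_eq_2)
  then have "of_int (m 2 * k 0 * k 1) * \<omega>\<^sup>2 + of_int (m 1 * k 0 * k 2) * \<omega> + of_int (m 0 * k 1 * k 2) = 0"
    using mk(1)[of 0] mk(1)[of 1] mk(1)[of 2] by (simp add: mk(2) field_simps)
  then show ?thesis using m2 mk(1)
    by (intro that[of "m 2 * k 0 * k 1" "m 1 * k 0 * k 2" "m 0 * k 1 * k 2"]) simp_all
qed

text \<open>Multiplying the quadratic equation of \<open>\<omega>\<close> by its leading coefficient
  \<open>a\<close> shows that \<open>a * \<omega>\<close> is integral with trace \<open>- b\<close>
  and norm \<open>a * c\<close>.\<close>

lemma real_quadratic_multiple:
  assumes "algebraic \<omega>" "alg_degree \<omega> = 2" "\<omega> \<notin> \<rat>"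
  obtains a t n :: int and \<theta>' where "a \<noteq> 0" "real_quadratic t n (of_int a * \<omega>) \<theta>'"
proof -
  obtain a b c where abc: "a \<noteq> 0" "of_int a * \<omega>\<^sup>2 + of_int b * \<omega> + of_int c = 0"
    using quadratic_irrational_root[OF assms] .
  have "real_quadratic (- b) (a * c) (of_int a * \<omega>) (of_int (- b) - of_int a * \<omega>)"
  proof
    have "of_int a * \<omega> * (of_int (- b) - of_int a * \<omega>)
        = of_int a * of_int c - of_int a * (of_int a * \<omega>\<^sup>2 + of_int b * \<omega> + of_int c)"
      by (simp add: algebra_simps power2_eq_square)
    then show "of_int a * \<omega> * (of_int (- b) - of_int a * \<omega>) = of_int (a * c)"
      using abc(2) by simp
    show "of_int a * \<omega> \<notin> \<rat>"
      using assms(3) abc(1) by (metis Rats_divide Rats_of_int nonzero_mult_div_cancel_left of_int_eq_0_iff)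
  qed simp
  with abc(1) show ?thesis using that by blast
qed

text \<open>Multiplication by \<open>a\<close>, as a map from coordinates with respect to
  \<open>1, \<omega>\<close> to coordinates with respect to \<open>1, a * \<omega>\<close>.\<close>

definition scale_pair :: "int \<Rightarrow> int \<times> int \<Rightarrow> int \<times> int" where
  "scale_pair a z = (a * fst z, snd z)"

lemma quadratic_emb_scale_pair:
  "quadratic_emb (of_int a * \<omega>) (scale_pair a z) = of_int a * quadratic_emb \<omega> z"
  by (simp add: quadratic_emb_def scale_pair_def algebra_simps)

lemma scale_pair_in_box:
  assumes "z \<in> int_pair_box C" "a \<noteq> 0"
  shows "scale_pair a z \<in> int_pair_box (of_int \<bar>a\<bar> * C)"
proof -
  have "\<bar>real_of_int (fst z)\<bar> \<le> C" "\<bar>real_of_int (snd z)\<bar> \<le> C"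
    using assms(1) by (auto simp: int_pair_box_def)
  moreover have "1 \<le> \<bar>real_of_int a\<bar>" using assms(2) by linarith
  moreover from this have "1 * C \<le> \<bar>real_of_int a\<bar> * C"
    using calculation by (intro mult_right_mono) linarith+
  ultimately show ?thesis
    by (auto simp: int_pair_box_def scale_pair_def abs_mult mult_left_mono)
qed

text \<open>Multiplying both factors by \<open>a\<close> maps the factorizations of \<open>M\<close>
  injectively to factorizations of \<open>a\<^sup>2 * M\<close> in a box larger by the factor
  \<open>\<bar>a\<bar>\<close>.\<close>

lemma card_factorizations_quadratic_irrational:
  fixes \<eta> :: real
  assumes "algebraic \<omega>" "alg_degree \<omega> = 2" "\<omega> \<notin> \<rat>" and "\<eta> > 0"
  shows "\<exists>K>0. \<forall>C\<ge>1. \<forall>M. M \<noteq> 0 \<longrightarrow>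
    real (card {(z, w). z \<in> int_pair_box C \<and> w \<in> int_pair_box C
      \<and> quadratic_emb \<omega> z * quadratic_emb \<omega> w = M}) \<le> K * C powr \<eta>"
proof -
  obtain a t n \<theta>' where a: "a \<noteq> 0" and rq: "real_quadratic t n (of_int a * \<omega>) \<theta>'"
    using real_quadratic_multiple[OF assms(1-3)] .
  interpret real_quadratic t n "of_int a * \<omega>" \<theta>' by (rule rq)
  obtain K where K: "K > 0" "\<And>C M. C \<ge> 1 \<Longrightarrow> M \<noteq> 0 \<Longrightarrow>
    real (card {(z, w). z \<in> int_pair_box C \<and> w \<in> int_pair_box C
      \<and> quadratic_emb (of_int a * \<omega>) z * quadratic_emb (of_int a * \<omega>) w = M}) \<le> K * C powr \<eta>"
    using card_factorizations_le[OF assms(4)] by auto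
  let ?A = "real_of_int \<bar>a\<bar>"
  have A: "?A \<ge> 1" using a by linarith
  have "real (card {(z, w). z \<in> int_pair_box C \<and> w \<in> int_pair_box C
      \<and> quadratic_emb \<omega> z * quadratic_emb \<omega> w = M}) \<le> (K * ?A powr \<eta>) * C powr \<eta>"
    if C: "C \<ge> 1" and M: "M \<noteq> 0" for C M
  proof -
    let ?S = "{(z, w). z \<in> int_pair_box C \<and> w \<in> int_pair_box C
      \<and> quadratic_emb \<omega> z * quadratic_emb \<omega> w = M}"
    let ?S' = "{(z, w). z \<in> int_pair_box (?A * C) \<and> w \<in> int_pair_box (?A * C)
      \<and> quadratic_emb (of_int a * \<omega>) z * quadratic_emb (of_int a * \<omega>) w = (of_int a)\<^sup>2 * M}"
    have "inj_on (map_prod (scale_pair a) (scale_pair a)) ?S"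
      using a by (auto simp: inj_on_def scale_pair_def prod_eq_iff)
    moreover have "map_prod (scale_pair a) (scale_pair a) ` ?S \<subseteq> ?S'"
      using scale_pair_in_box[OF _ a]
      by (auto simp: quadratic_emb_scale_pair power2_eq_square simp del: of_int_abs)
    moreover have "finite ?S'"
      by (rule finite_subset[of _ "int_pair_box (?A * C) \<times> int_pair_box (?A * C)"]) auto
    ultimately have "card ?S \<le> card ?S'" by (rule card_inj_on_le)
    also have "real (card ?S') \<le> K * (?A * C) powr \<eta>"
    proof (rule K(2))
      show "?A * C \<ge> 1" using A C mult_mono[of 1 ?A 1 C] by simp
      show "(of_int a)\<^sup>2 * M \<noteq> 0" using a M by simp
    qed
    also have "\<dots> = (K * ?A powr \<eta>) * C powr \<eta>"
      using A C by (simp add: powr_mult)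
    finally show ?thesis by simp
  qed
  moreover have "K * ?A powr \<eta> > 0" using K(1) A by simp
  ultimately show ?thesis by blast
qed

lemma products_separated_quadratic_irrational:
  assumes "algebraic \<omega>" "alg_degree \<omega> = 2" "\<omega> \<notin> \<rat>"
  shows "\<exists>c>0. \<forall>C\<ge>1. \<forall>z\<in>int_pair_box C. \<forall>w\<in>int_pair_box C. \<forall>z'\<in>int_pair_box C. \<forall>w'\<in>int_pair_box C.
    quadratic_emb \<omega> z * quadratic_emb \<omega> w \<noteq> quadratic_emb \<omega> z' * quadratic_emb \<omega> w' \<longrightarrow>
    \<bar>quadratic_emb \<omega> z * quadratic_emb \<omega> w - quadratic_emb \<omega> z' * quadratic_emb \<omega> w'\<bar> \<ge> c / C\<^sup>2"
proof -
  obtain a t n \<theta>' where a: "a \<noteq> 0" and rq: "real_quadratic t n (of_int a * \<omega>) \<theta>'"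
    using real_quadratic_multiple[OF assms] .
  interpret real_quadratic t n "of_int a * \<omega>" \<theta>' by (rule rq)
  let ?A = "real_of_int \<bar>a\<bar>"
  have A: "?A \<ge> 1" using a by linarith
  \<comment> \<open>The constant of \<open>products_separated\<close>, divided by
    \<open>\<bar>a\<bar>\<^sup>2\<close> for the enlarged box and by \<open>a\<^sup>2\<close>
    because products grow by this factor.\<close>
  define c where "c = 1 / (2 * (1 + \<bar>\<theta>'\<bar>)\<^sup>2) / ?A\<^sup>2 / (of_int a)\<^sup>2"
  have "c > 0" using a by (simp add: c_def add_pos_nonneg)
  moreover have "\<bar>quadratic_emb \<omega> z * quadratic_emb \<omega> w - quadratic_emb \<omega> z' * quadratic_emb \<omega> w'\<bar> \<ge> c / C\<^sup>2"
    if C: "C \<ge> 1"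
      and box: "z \<in> int_pair_box C" "w \<in> int_pair_box C" "z' \<in> int_pair_box C" "w' \<in> int_pair_box C"
      and neq: "quadratic_emb \<omega> z * quadratic_emb \<omega> w \<noteq> quadratic_emb \<omega> z' * quadratic_emb \<omega> w'"
    for C z w z' w'
  proof -
    have "?A * C \<ge> 1" using A C mult_mono[of 1 ?A 1 C] by simp
    have eq: "quadratic_emb (of_int a * \<omega>) (scale_pair a x) * quadratic_emb (of_int a * \<omega>) (scale_pair a y)
      = (of_int a)\<^sup>2 * (quadratic_emb \<omega> x * quadratic_emb \<omega> y)" for x y
      by (simp add: quadratic_emb_scale_pair power2_eq_square)
    have "(of_int a)\<^sup>2 * (quadratic_emb \<omega> z * quadratic_emb \<omega> w)
        \<noteq> (of_int a)\<^sup>2 * (quadratic_emb \<omega> z' * quadratic_emb \<omega> w')"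
      using neq a by simp
    from products_separated[OF \<open>?A * C \<ge> 1\<close> box[THEN scale_pair_in_box[OF _ a]], unfolded eq, OF this]
    have "1 / (2 * (1 + \<bar>\<theta>'\<bar>)\<^sup>2) / (?A * C)\<^sup>2
      \<le> (of_int a)\<^sup>2 * \<bar>quadratic_emb \<omega> z * quadratic_emb \<omega> w - quadratic_emb \<omega> z' * quadratic_emb \<omega> w'\<bar>"
      by (simp only: right_diff_distrib[symmetric] abs_mult abs_power2)
    then have "1 / (2 * (1 + \<bar>\<theta>'\<bar>)\<^sup>2) / (?A * C)\<^sup>2 / (of_int a)\<^sup>2
      \<le> \<bar>quadratic_emb \<omega> z * quadratic_emb \<omega> w - quadratic_emb \<omega> z' * quadratic_emb \<omega> w'\<bar>"
      using a by (subst pos_divide_le_eq) (simp_all only: mult.commute zero_less_power2 of_int_eq_0_iff not_False_eq_True)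
    moreover have "c / C\<^sup>2 = 1 / (2 * (1 + \<bar>\<theta>'\<bar>)\<^sup>2) / (?A * C)\<^sup>2 / (of_int a)\<^sup>2"
      by (simp only: c_def power_mult_distrib divide_divide_eq_left mult_ac)
    ultimately show ?thesis by linarith
  qed
  ultimately show ?thesis by blast
qed

section \<open>Mean values of trigonometric sums\<close>


text \<open>Termwise primitive of \<open>trig_square_expand\<close>. Diagonal terms grow linearly
  while the others stay bounded, and from this both the mean over \<open>x\<close> and the large
  sieve in \<open>t\<close> are read off.\<close>

definition trig_square_antideriv :: "real set \<Rightarrow> (real \<Rightarrow> complex) \<Rightarrow> real \<Rightarrow> real" where
  "trig_square_antideriv A b t = (\<Sum>x\<in>A. \<Sum>y\<in>A. if x = y then (norm (b x))\<^sup>2 * t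
     else Im (b x * cnj (b y) * cis (2 * pi * (x - y) * t)) / (2 * pi * (x - y)))"

lemma trig_square_expand:
  "(norm (\<Sum>x\<in>A. b x * cis (2 * pi * x * t)))\<^sup>2
    = (\<Sum>x\<in>A. \<Sum>y\<in>A. Re (b x * cnj (b y) * cis (2 * pi * (x - y) * t)))"
proof -
  let ?S = "\<Sum>x\<in>A. b x * cis (2 * pi * x * t)"
  have "complex_of_real ((norm ?S)\<^sup>2) = ?S * cnj ?S"
    by (rule complex_norm_square)
  also have "\<dots> = (\<Sum>x\<in>A. \<Sum>y\<in>A. (b x * cis (2 * pi * x * t)) * (cnj (b y) * cis (- (2 * pi * y * t))))"
    by (simp add: cis_cnj sum_product)
  also have "\<dots> = (\<Sum>x\<in>A. \<Sum>y\<in>A. b x * cnj (b y) * (cis (2 * pi * x * t) * cis (- (2 * pi * y * t))))"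
    by (simp add: mult_ac)
  also have "\<dots> = (\<Sum>x\<in>A. \<Sum>y\<in>A. b x * cnj (b y) * cis (2 * pi * (x - y) * t))"
    by (simp add: cis_mult algebra_simps)
  finally have "Re (complex_of_real ((norm ?S)\<^sup>2)) = Re (\<Sum>x\<in>A. \<Sum>y\<in>A. b x * cnj (b y) * cis (2 * pi * (x - y) * t))"
    by simp
  then show ?thesis by simp
qed

lemma DERIV_Im_cis:
  assumes "\<nu> \<noteq> 0"
  shows "((\<lambda>t. Im (c * cis (2 * pi * \<nu> * t)) / (2 * pi * \<nu>)) has_real_derivative
    Re (c * cis (2 * pi * \<nu> * t))) (at t)"
proof -
  define \<kappa> where "\<kappa> = 2 * pi * \<nu>"
  have "((\<lambda>t. Re c * sin (\<kappa> * t) + Im c * cos (\<kappa> * t)) has_real_derivative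
    \<kappa> * (Re c * cos (\<kappa> * t) - Im c * sin (\<kappa> * t))) (at t)"
    by (auto intro!: derivative_eq_intros simp: algebra_simps)
  from DERIV_cdivide[OF this, of \<kappa>] show ?thesis
    using assms by (simp add: \<kappa>_def)
qed

lemma DERIV_trig_square_antideriv:
  "(trig_square_antideriv A b has_real_derivative (norm (\<Sum>x\<in>A. b x * cis (2 * pi * x * t)))\<^sup>2) (at t)"
proof -
  have "((\<lambda>t. if x = y then (norm (b x))\<^sup>2 * t
      else Im (b x * cnj (b y) * cis (2 * pi * (x - y) * t)) / (2 * pi * (x - y))) has_real_derivative
      Re (b x * cnj (b y) * cis (2 * pi * (x - y) * t))) (at t)" for x y
  proof (cases "x = y")
    case True
    have "Re (b x * cnj (b x)) = (norm (b x))\<^sup>2"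
      by (metis Re_complex_of_real complex_norm_square)
    then show ?thesis using True by (auto intro!: derivative_eq_intros)
  next
    case False
    then have "x - y \<noteq> 0" by simp
    from DERIV_Im_cis[OF this, of "b x * cnj (b y)" t] show ?thesis
      using False by (simp only: if_False)
  qed
  then show ?thesis
    unfolding trig_square_expand trig_square_antideriv_def[abs_def] by (intro DERIV_sum)
qed

lemma nn_integral_trig_square:
  assumes "l \<le> u"
  shows "(\<integral>\<^sup>+t\<in>{l..u}. ennreal ((norm (\<Sum>x\<in>A. b x * cis (2 * pi * x * t)))\<^sup>2) \<partial>lborel)
    = ennreal (trig_square_antideriv A b u - trig_square_antideriv A b l)"
  using assms
  by (intro nn_integral_FTC_Icc DERIV_trig_square_antideriv)
     (auto intro!: borel_measurable_continuous_onI continuous_intros)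

lemma trig_square_antideriv_diff:
  assumes "finite A"
  shows "\<bar>(trig_square_antideriv A b u - trig_square_antideriv A b l) - (u - l) * (\<Sum>x\<in>A. (norm (b x))\<^sup>2)\<bar>
    \<le> (\<Sum>x\<in>A. \<Sum>y\<in>A-{x}. norm (b x) * norm (b y) / \<bar>x - y\<bar>)"
proof -
  define g where "g x y t = Im (b x * cnj (b y) * cis (2 * pi * (x - y) * t)) / (2 * pi * (x - y))" for x y t
  have g: "\<bar>g x y t\<bar> \<le> norm (b x) * norm (b y) / (2 * \<bar>x - y\<bar>)" if "x \<noteq> y" for x y t
  proof -
    have "\<bar>Im (b x * cnj (b y) * cis (2 * pi * (x - y) * t))\<bar> \<le> norm (b x) * norm (b y)"
      by (rule order_trans[OF abs_Im_le_cmod]) (simp add: norm_mult)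
    then have "\<bar>g x y t\<bar> \<le> norm (b x) * norm (b y) / (2 * pi * \<bar>x - y\<bar>)"
      unfolding g_def abs_divide by (simp add: abs_mult divide_right_mono)
    \<comment> \<open>Dropping \<open>pi\<close> leaves half of the wanted bound at each of the two
      endpoints.\<close>
    also have "\<dots> \<le> norm (b x) * norm (b y) / (2 * \<bar>x - y\<bar>)"
      using that pi_ge_two by (intro frac_le) auto
    finally show ?thesis .
  qed
  have F: "trig_square_antideriv A b t = (\<Sum>x\<in>A. (norm (b x))\<^sup>2 * t + (\<Sum>y\<in>A-{x}. g x y t))" for t
    unfolding trig_square_antideriv_def
  proof (rule sum.cong[OF refl])
    fix x assume "x \<in> A"
    have "(\<Sum>y\<in>A. if x = y then (norm (b x))\<^sup>2 * t else g x y t)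
        = (norm (b x))\<^sup>2 * t + (\<Sum>y\<in>A-{x}. if x = y then (norm (b x))\<^sup>2 * t else g x y t)"
      using sum.remove[OF assms \<open>x \<in> A\<close>, of "\<lambda>y. if x = y then (norm (b x))\<^sup>2 * t else g x y t"] by simp
    also have "(\<Sum>y\<in>A-{x}. if x = y then (norm (b x))\<^sup>2 * t else g x y t) = (\<Sum>y\<in>A-{x}. g x y t)"
      by (intro sum.cong) auto
    finally show "(\<Sum>y\<in>A. if x = y then (norm (b x))\<^sup>2 * t
        else Im (b x * cnj (b y) * cis (2 * pi * (x - y) * t)) / (2 * pi * (x - y)))
        = (norm (b x))\<^sup>2 * t + (\<Sum>y\<in>A-{x}. g x y t)"
      by (simp only: g_def)
  qed
  have "(trig_square_antideriv A b u - trig_square_antideriv A b l) - (u - l) * (\<Sum>x\<in>A. (norm (b x))\<^sup>2)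
    = (\<Sum>x\<in>A. \<Sum>y\<in>A-{x}. g x y u - g x y l)"
    unfolding F by (simp add: sum.distrib sum_subtractf sum_distrib_left algebra_simps)
  also have "\<bar>\<dots>\<bar> \<le> (\<Sum>x\<in>A. \<Sum>y\<in>A-{x}. \<bar>g x y u - g x y l\<bar>)"
    by (intro order_trans[OF sum_abs] sum_mono sum_abs)
  also have "\<dots> \<le> (\<Sum>x\<in>A. \<Sum>y\<in>A-{x}. norm (b x) * norm (b y) / \<bar>x - y\<bar>)"
  proof (intro sum_mono)
    fix x y assume "y \<in> A - {x}"
    then have "x \<noteq> y" by auto
    from g[OF this, of u] g[OF this, of l]
    have "\<bar>g x y u - g x y l\<bar> \<le> 2 * (norm (b x) * norm (b y) / (2 * \<bar>x - y\<bar>))" by linarith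
    then show "\<bar>g x y u - g x y l\<bar> \<le> norm (b x) * norm (b y) / \<bar>x - y\<bar>" by simp
  qed
  finally show ?thesis .
qed

section \<open>The large sieve inequality\<close>

lemma sum_inverse_separated_le:
  fixes A :: "real set"
  assumes fin: "finite A" and \<delta>: "\<delta> > 0" and Q: "Q > 0"
    and range: "\<And>x. x \<in> A \<Longrightarrow> \<delta> \<le> x \<and> x \<le> \<delta> * real Q"
    and sep: "\<And>x y. x \<in> A \<Longrightarrow> y \<in> A \<Longrightarrow> x \<noteq> y \<Longrightarrow> \<delta> \<le> \<bar>x - y\<bar>"
  shows "(\<Sum>x\<in>A. 1 / x) \<le> (1 + ln (real Q)) / \<delta>"
proof -
  \<comment> \<open>Each cell of length \<open>\<delta>\<close> contains at most one point, so the
    cell numbers are distinct elements of \<open>{1..Q}\<close> and the sum is compared with a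
    harmonic sum.\<close>
  define q where "q x = nat \<lfloor>x / \<delta>\<rfloor>" for x
  have q: "real (q x) \<le> x / \<delta>" "x / \<delta> < real (q x) + 1" "1 \<le> q x" "q x \<le> Q" if "x \<in> A" for x
  proof -
    have x: "1 \<le> x / \<delta>" "x / \<delta> \<le> real Q" using range[OF that] \<delta> by (simp_all add: field_simps)
    then show "real (q x) \<le> x / \<delta>" "x / \<delta> < real (q x) + 1" unfolding q_def by linarith+
    then show "1 \<le> q x" "q x \<le> Q" using x by linarith+
  qed
  have inj: "inj_on q A"
  proof (rule inj_onI)
    fix x y assume xy: "x \<in> A" "y \<in> A" "q x = q y"
    then have "\<bar>x / \<delta> - y / \<delta>\<bar> < 1" using q(1,2)[of x] q(1,2)[of y] by linarith
    then have "\<bar>x - y\<bar> < \<delta>" using \<delta> by (simp add: abs_less_iff field_simps)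
    then show "x = y" using sep[OF xy(1,2)] by linarith
  qed
  have "(\<Sum>x\<in>A. 1 / x) \<le> (\<Sum>x\<in>A. inverse (real (q x)) / \<delta>)"
  proof (rule sum_mono)
    fix x assume x: "x \<in> A"
    have "\<delta> * real (q x) \<le> x" "0 < real (q x)" using q[OF x] \<delta> by (simp_all add: field_simps)
    then have "1 / x \<le> 1 / (\<delta> * real (q x))" using \<delta> by (intro frac_le) auto
    then show "1 / x \<le> inverse (real (q x)) / \<delta>" by (simp add: divide_inverse mult_ac)
  qed
  also have "\<dots> = (\<Sum>k\<in>q ` A. inverse (real k)) / \<delta>"
    by (simp add: sum.reindex[OF inj] sum_divide_distrib)
  also have "\<dots> \<le> harm Q / \<delta>"
    unfolding harm_def using q(3,4) \<delta> by (intro divide_right_mono sum_mono2) auto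
  \<comment> \<open>The sequence \<open>harm k - ln k\<close> decreases and starts with the value
    1.\<close>
  also have "harm Q \<le> 1 + ln (real Q)"
    using euler_mascheroni_sequence_decreasing[of 1 Q] Q by (simp add: harm_expand)
  finally show ?thesis using \<delta> by (simp add: divide_right_mono)
qed

text \<open>The distances to the points on one side of \<open>x\<close> form a separated set as in
  \<open>sum_inverse_separated_le\<close>; the two sides, selected by the sign
  \<open>\<sigma>\<close>, give the factor 2.\<close>

lemma sum_inverse_dist_separated_le:
  fixes A :: "real set"
  assumes fin: "finite A" and \<delta>: "\<delta> > 0" and Q: "Q > 0" and x: "x \<in> A"
    and sep: "\<And>x y. x \<in> A \<Longrightarrow> y \<in> A \<Longrightarrow> x \<noteq> y \<Longrightarrow> \<delta> \<le> \<bar>x - y\<bar> \<and> \<bar>x - y\<bar> \<le> \<delta> * real Q"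
  shows "(\<Sum>y\<in>A-{x}. 1 / \<bar>x - y\<bar>) \<le> 2 * (1 + ln (real Q)) / \<delta>"
proof -
  have half: "(\<Sum>y\<in>B. 1 / (\<sigma> * (y - x))) \<le> (1 + ln (real Q)) / \<delta>"
    if B: "B \<subseteq> A" "\<And>y. y \<in> B \<Longrightarrow> \<sigma> * (y - x) > 0" and \<sigma>: "\<bar>\<sigma>\<bar> = 1" for B \<sigma>
  proof -
    have inj: "inj_on (\<lambda>y. \<sigma> * (y - x)) B" using \<sigma> by (auto simp: inj_on_def)
    have "(\<Sum>z\<in>(\<lambda>y. \<sigma> * (y - x)) ` B. 1 / z) \<le> (1 + ln (real Q)) / \<delta>"
    proof (rule sum_inverse_separated_le)
      show "finite ((\<lambda>y. \<sigma> * (y - x)) ` B)" using fin B(1) by (simp add: finite_subset)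
      fix z assume "z \<in> (\<lambda>y. \<sigma> * (y - x)) ` B"
      then obtain y where y: "y \<in> B" "z = \<sigma> * (y - x)" by blast
      then have "\<bar>y - x\<bar> = z" using B(2)[of y] \<sigma> by (metis abs_mult abs_of_pos mult_1)
      moreover have "y \<noteq> x" using B(2)[OF y(1)] by auto
      ultimately show "\<delta> \<le> z \<and> z \<le> \<delta> * real Q" using sep[of y x] x y B(1) by auto
    next
      fix z z' assume z: "z \<in> (\<lambda>y. \<sigma> * (y - x)) ` B" "z' \<in> (\<lambda>y. \<sigma> * (y - x)) ` B" "z \<noteq> z'"
      then obtain y y' where y: "y \<in> B" "y' \<in> B" "z = \<sigma> * (y - x)" "z' = \<sigma> * (y' - x)" by blast
      have "z - z' = \<sigma> * (y - y')" by (simp add: y algebra_simps)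
      then have "\<bar>z - z'\<bar> = \<bar>y - y'\<bar>" using \<sigma> by (simp add: abs_mult)
      then show "\<delta> \<le> \<bar>z - z'\<bar>" using sep[of y y'] y z(3) B(1) by auto
    qed (use \<delta> Q in auto)
    then show ?thesis by (simp add: sum.reindex[OF inj])
  qed
  have split: "A - {x} = {y \<in> A. y > x} \<union> {y \<in> A. y < x}" by auto
  have "(\<Sum>y\<in>A-{x}. 1 / \<bar>x - y\<bar>) = (\<Sum>y\<in>{y \<in> A. y > x}. 1 / \<bar>x - y\<bar>) + (\<Sum>y\<in>{y \<in> A. y < x}. 1 / \<bar>x - y\<bar>)"
    unfolding split using fin by (intro sum.union_disjoint) auto
  also have "\<dots> = (\<Sum>y\<in>{y \<in> A. y > x}. 1 / (1 * (y - x))) + (\<Sum>y\<in>{y \<in> A. y < x}. 1 / ((-1) * (y - x)))"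
    by (intro arg_cong2[where f = "(+)"] sum.cong) auto
  also have "\<dots> \<le> (1 + ln (real Q)) / \<delta> + (1 + ln (real Q)) / \<delta>"
    by (intro add_mono half) auto
  finally show ?thesis by (simp add: field_simps)
qed

text \<open>The logarithm is the loss of Schur's test.\<close>

lemma large_sieve:
  fixes A :: "real set" and b :: "real \<Rightarrow> complex" and \<delta> T :: real and Q :: nat
  assumes fin: "finite A" and \<delta>: "\<delta> > 0" and Q: "Q > 0" and T: "T \<ge> 0"
    and sep: "\<And>x y. x \<in> A \<Longrightarrow> y \<in> A \<Longrightarrow> x \<noteq> y \<Longrightarrow> \<delta> \<le> \<bar>x - y\<bar> \<and> \<bar>x - y\<bar> \<le> \<delta> * real Q"
  shows "(\<integral>\<^sup>+t\<in>{0..T}. ennreal ((norm (\<Sum>x\<in>A. b x * cis (2 * pi * x * t)))\<^sup>2) \<partial>lborel)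
    \<le> ennreal ((T + 2 * (1 + ln (real Q)) / \<delta>) * (\<Sum>x\<in>A. (norm (b x))\<^sup>2))"
proof -
  define w where "w x y = (if x = y then 0 else 1 / \<bar>x - y\<bar>)" for x y :: real
  let ?B = "2 * (1 + ln (real Q)) / \<delta>"
  have w_sym: "w x y = w y x" for x y
    unfolding w_def by (metis abs_minus_commute)
  have w_nonneg: "w x y \<ge> 0" for x y
    by (simp add: w_def)
  have w_sum: "(\<Sum>y\<in>A. w x y) \<le> ?B" if "x \<in> A" for x
  proof -
    have "(\<Sum>y\<in>A. w x y) = w x x + (\<Sum>y\<in>A-{x}. w x y)"
      using fin that by (rule sum.remove)
    also have "\<dots> = (\<Sum>y\<in>A-{x}. 1 / \<bar>x - y\<bar>)"
      by (auto simp: w_def intro!: sum.cong)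
    also have "\<dots> \<le> ?B"
      by (rule sum_inverse_dist_separated_le[OF fin \<delta> Q that]) (rule sep)
    finally show ?thesis .
  qed
  have swap: "(\<Sum>x\<in>A. \<Sum>y\<in>A. (norm (b y))\<^sup>2 / 2 * w x y) = (\<Sum>x\<in>A. \<Sum>y\<in>A. (norm (b x))\<^sup>2 / 2 * w x y)"
    by (subst sum.swap, intro sum.cong refl) (simp only: w_sym)
  have "(\<Sum>x\<in>A. \<Sum>y\<in>A-{x}. norm (b x) * norm (b y) / \<bar>x - y\<bar>)
      = (\<Sum>x\<in>A. \<Sum>y\<in>A. norm (b x) * norm (b y) * w x y)"
    by (rule sum.cong[OF refl], rule sum.mono_neutral_cong_left) (auto simp: fin w_def)
  \<comment> \<open>The inequality of arithmetic and geometric means together with the symmetry of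
    \<open>w\<close> leaves only row sums of \<open>w\<close> to be bounded.\<close>
  also have "\<dots> \<le> (\<Sum>x\<in>A. \<Sum>y\<in>A. ((norm (b x))\<^sup>2 + (norm (b y))\<^sup>2) / 2 * w x y)"
  proof (intro sum_mono mult_right_mono)
    fix x y
    show "norm (b x) * norm (b y) \<le> ((norm (b x))\<^sup>2 + (norm (b y))\<^sup>2) / 2"
      using sum_squares_bound[of "norm (b x)" "norm (b y)"] by simp
  qed (rule w_nonneg)
  also have "\<dots> = (\<Sum>x\<in>A. \<Sum>y\<in>A. (norm (b x))\<^sup>2 / 2 * w x y) + (\<Sum>x\<in>A. \<Sum>y\<in>A. (norm (b y))\<^sup>2 / 2 * w x y)"
    by (simp only: add_divide_distrib distrib_right sum.distrib)
  also have "\<dots> = (\<Sum>x\<in>A. \<Sum>y\<in>A. (norm (b x))\<^sup>2 / 2 * w x y) + (\<Sum>x\<in>A. \<Sum>y\<in>A. (norm (b x))\<^sup>2 / 2 * w x y)"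
    unfolding swap ..
  also have "\<dots> = (\<Sum>x\<in>A. (norm (b x))\<^sup>2 * (\<Sum>y\<in>A. w x y))"
    by (simp only: sum_distrib_left sum.distrib[symmetric] distrib_right[symmetric] field_sum_of_halves)
  also have "\<dots> \<le> (\<Sum>x\<in>A. (norm (b x))\<^sup>2 * ?B)"
    using w_sum by (intro sum_mono mult_left_mono) auto
  finally have "trig_square_antideriv A b T - trig_square_antideriv A b 0
      \<le> T * (\<Sum>x\<in>A. (norm (b x))\<^sup>2) + (\<Sum>x\<in>A. (norm (b x))\<^sup>2 * ?B)"
    using trig_square_antideriv_diff[OF fin, of b T 0] by (simp only: diff_0_right)
  also have "\<dots> = (T + ?B) * (\<Sum>x\<in>A. (norm (b x))\<^sup>2)"
    unfolding sum_distrib_right[symmetric] distrib_right by (rule arg_cong2[where f = "(+)", OF refl mult.commute])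
  finally show ?thesis
    unfolding nn_integral_trig_square[OF T] by (rule ennreal_leI)
qed


text \<open>The off-diagonal error in \<open>trig_square_antideriv_diff\<close> is independent of
  the interval and disappears after division by \<open>2 * L\<close>.\<close>

lemma tendsto_mean_trig_square:
  fixes A :: "real set" and b :: "real \<Rightarrow> complex"
  assumes "finite A"
  shows "((\<lambda>L. (\<integral>\<^sup>+x\<in>{-L..L}. ennreal ((norm (\<Sum>s\<in>A. b s * cis (2 * pi * s * x)))\<^sup>2) \<partial>lborel) / ennreal (2 * L))
    \<longlongrightarrow> ennreal (\<Sum>s\<in>A. (norm (b s))\<^sup>2)) at_top"
proof -
  define F where "F L = trig_square_antideriv A b L - trig_square_antideriv A b (-L)" for L
  define E where "E = (\<Sum>s\<in>A. (norm (b s))\<^sup>2)"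
  define W where "W = (\<Sum>x\<in>A. \<Sum>y\<in>A-{x}. norm (b x) * norm (b y) / \<bar>x - y\<bar>)"
  have F: "\<bar>F L - 2 * L * E\<bar> \<le> W" for L
    using trig_square_antideriv_diff[OF assms, of b L "-L"] by (simp add: F_def E_def W_def)
  have "((\<lambda>L. F L / (2 * L) - E) \<longlongrightarrow> 0) at_top"
  proof (rule Lim_null_comparison)
    show "\<forall>\<^sub>F L in at_top. norm (F L / (2 * L) - E) \<le> W / (2 * L)"
    proof (rule eventually_mono[OF eventually_gt_at_top[of 0]])
      fix L :: real assume L: "0 < L"
      have "F L / (2 * L) - E = (F L - 2 * L * E) / (2 * L)" using L by (simp add: field_simps)
      then show "norm (F L / (2 * L) - E) \<le> W / (2 * L)"
        using F[of L] L by (simp add: divide_right_mono)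
    qed
    show "((\<lambda>L. W / (2 * L)) \<longlongrightarrow> 0) at_top"
      by (intro tendsto_divide_0[OF tendsto_const] filterlim_at_top_imp_at_infinity
          filterlim_tendsto_pos_mult_at_top[OF tendsto_const _ filterlim_ident]) simp
  qed
  then have "((\<lambda>L. F L / (2 * L)) \<longlongrightarrow> E) at_top"
    by (rule LIM_zero_cancel)
  then have "((\<lambda>L. ennreal (F L / (2 * L))) \<longlongrightarrow> ennreal E) at_top"
    by (rule tendsto_ennrealI)
  moreover have "\<forall>\<^sub>F L in at_top. ennreal (F L / (2 * L)) =
    (\<integral>\<^sup>+x\<in>{-L..L}. ennreal ((norm (\<Sum>s\<in>A. b s * cis (2 * pi * s * x)))\<^sup>2) \<partial>lborel) / ennreal (2 * L)"
  proof (rule eventually_mono[OF eventually_gt_at_top[of 0]])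
    fix L :: real assume L: "0 < L"
    have "trig_square_antideriv A b (-L) \<le> trig_square_antideriv A b L"
    proof (rule DERIV_nonneg_imp_nondecreasing[where f = "trig_square_antideriv A b"])
      show "-L \<le> L" using L by simp
      show "\<exists>y. (trig_square_antideriv A b has_real_derivative y) (at x) \<and> 0 \<le> y" for x
        using DERIV_trig_square_antideriv zero_le_power2 by blast
    qed
    then have "F L \<ge> 0" by (simp add: F_def)
    then show "ennreal (F L / (2 * L)) =
      (\<integral>\<^sup>+x\<in>{-L..L}. ennreal ((norm (\<Sum>s\<in>A. b s * cis (2 * pi * s * x)))\<^sup>2) \<partial>lborel) / ennreal (2 * L)"
      using L by (simp add: nn_integral_trig_square F_def[symmetric] divide_ennreal)
  qed
  ultimately show ?thesis
    unfolding E_def by (rule Lim_transform_eventually)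
qed

text \<open>Mean values are computed exactly only for squares of trigonometric sums; other powers
  are handled by pointwise domination by such a square.\<close>

lemma Limsup_mean_le:
  fixes A :: "real set" and b :: "real \<Rightarrow> complex" and f :: "real \<Rightarrow> complex"
  assumes "finite A"
    and "\<And>x. norm (f x) powr p \<le> (norm (\<Sum>s\<in>A. b s * cis (2 * pi * s * x)))\<^sup>2"
  shows "Limsup at_top (\<lambda>L :: real. (\<integral>\<^sup>+x\<in>{-L..L}. ennreal (norm (f x) powr p) \<partial>lborel) / ennreal (2 * L))
    \<le> ennreal (\<Sum>s\<in>A. (norm (b s))\<^sup>2)"
proof -
  let ?G = "\<lambda>L. (\<integral>\<^sup>+x\<in>{-L..L}. ennreal ((norm (\<Sum>s\<in>A. b s * cis (2 * pi * s * x)))\<^sup>2) \<partial>lborel) / ennreal (2 * L)"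
  have "Limsup at_top (\<lambda>L :: real. (\<integral>\<^sup>+x\<in>{-L..L}. ennreal (norm (f x) powr p) \<partial>lborel) / ennreal (2 * L))
    \<le> Limsup at_top ?G"
    using assms(2)
    by (intro Limsup_mono always_eventually allI divide_right_mono_ennreal nn_integral_mono mult_right_mono ennreal_leI) auto
  also have "\<dots> = ennreal (\<Sum>s\<in>A. (norm (b s))\<^sup>2)"
    by (intro lim_imp_Limsup tendsto_mean_trig_square assms(1)) simp
  finally show ?thesis .
qed

lemma mean_norm_2_trig:
  fixes A :: "real set" and a :: "real \<Rightarrow> complex"
  assumes "finite A" "\<And>x. f x = (\<Sum>s\<in>A. a s * cis (2 * pi * s * x))"
  shows "mean_norm 2 f = ennreal (sqrt (\<Sum>s\<in>A. (norm (a s))\<^sup>2))"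
proof -
  let ?E = "\<Sum>s\<in>A. (norm (a s))\<^sup>2"
  have "Limsup at_top (\<lambda>L :: real. (\<integral>\<^sup>+x\<in>{-L..L}. ennreal (norm (f x) powr 2) \<partial>lborel) / ennreal (2 * L))
    = ennreal ?E"
    unfolding assms(2) powr_numeral[OF norm_ge_zero]
    by (intro lim_imp_Limsup tendsto_mean_trig_square assms(1)) simp
  moreover have "?E \<ge> 0" by (intro sum_nonneg) simp
  ultimately show ?thesis
    by (simp add: mean_norm_def ennreal_powr_def powr_half_sqrt)
qed

section \<open>Coefficients of trigonometric polynomials\<close>

lemma trig_sum_reindex:
  fixes w :: "real ^ 'n"
  assumes inj: "inj (freq w)"
  shows "(\<Sum>k\<in>S. c k * cis (g (freq w k))) = (\<Sum>\<xi>\<in>freq w ` S. c (inv (freq w) \<xi>) * cis (g \<xi>))"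
  using inj by (subst sum.reindex) (auto intro: inj_on_subset)

text \<open>The difference is the zero function, and its quadratic mean is the sum of the squares of
  the coefficient differences. This justifies the \<open>THE\<close> in
  \<open>trig_coeff\<close>.\<close>

lemma trig_sum_unique:
  fixes w :: "real ^ 'n"
  assumes inj: "inj (freq w)" and fin: "finite {k. a k \<noteq> 0}" "finite {k. b k \<noteq> 0}"
    and eq: "trig_sum w a = trig_sum w b"
  shows "a = b"
proof -
  define S where "S = {k. a k \<noteq> 0} \<union> {k. b k \<noteq> 0}"
  define c where "c k = a k - b k" for k
  have S: "finite S" using fin by (simp add: S_def)
  have "(\<Sum>k\<in>S. c k * cis (2 * pi * freq w k * x)) = 0" for x
  proof -
    have "trig_sum w a x = (\<Sum>k\<in>S. a k * cis (2 * pi * freq w k * x))"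
      "trig_sum w b x = (\<Sum>k\<in>S. b k * cis (2 * pi * freq w k * x))"
      unfolding trig_sum_def by (intro sum.mono_neutral_left S; auto simp: S_def)+
    then show ?thesis using eq by (simp add: c_def left_diff_distrib sum_subtractf)
  qed
  then have "(\<Sum>\<xi>\<in>freq w ` S. c (inv (freq w) \<xi>) * cis (2 * pi * \<xi> * x)) = 0" for x
    using trig_sum_reindex[OF inj, of c "\<lambda>\<xi>. 2 * pi * \<xi> * x" S] by simp
  then have "mean_norm 2 (\<lambda>x. 0) = ennreal (sqrt (\<Sum>\<xi>\<in>freq w ` S. (norm (c (inv (freq w) \<xi>)))\<^sup>2))"
    using S by (intro mean_norm_2_trig) auto
  moreover have "mean_norm 2 (\<lambda>x. 0) = ennreal (sqrt (\<Sum>\<xi>\<in>({} :: real set). (norm (0 :: complex))\<^sup>2))"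
    by (rule mean_norm_2_trig[of "{}" _ "\<lambda>_. 0"]) auto
  ultimately have "sqrt (\<Sum>\<xi>\<in>freq w ` S. (norm (c (inv (freq w) \<xi>)))\<^sup>2) = 0"
    using real_sqrt_ge_zero[OF sum_nonneg, of "freq w ` S" "\<lambda>\<xi>. (norm (c (inv (freq w) \<xi>)))\<^sup>2"]
    by simp
  then have "\<forall>\<xi>\<in>freq w ` S. (norm (c (inv (freq w) \<xi>)))\<^sup>2 = 0"
    using S by (subst (asm) real_sqrt_eq_0_iff, subst (asm) sum_nonneg_eq_0_iff) auto
  then have "c k = 0" if "k \<in> S" for k
    using that inj by simp
  then show "a = b" by (force simp: c_def S_def)
qed

lemma trig_coeff_trig_sum:
  fixes w :: "real ^ 'n"
  assumes "inj (freq w)" "finite {k. a k \<noteq> 0}"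
  shows "trig_coeff w (trig_sum w a) = a"
  unfolding trig_coeff_def using assms trig_sum_unique[OF assms(1)] by (intro the_equality) auto

lemma height_proj_trig_sum:
  fixes w :: "real ^ 'n"
  assumes "inj (freq w)" "finite {k. a k \<noteq> 0}"
  shows "height_proj w C (trig_sum w a) = trig_sum w
    (\<lambda>k. if C / 2 \<le> norm (lattice_vec k) \<and> norm (lattice_vec k) < C then a k else 0)"
proof (rule ext)
  fix x
  show "height_proj w C (trig_sum w a) x = trig_sum w
    (\<lambda>k. if C / 2 \<le> norm (lattice_vec k) \<and> norm (lattice_vec k) < C then a k else 0) x"
    unfolding height_proj_def trig_coeff_trig_sum[OF assms] trig_sum_def
    by (intro sum.cong) auto
qed

section \<open>The sixth moment\<close>


definition triple_sum :: "real \<times> real \<times> real \<Rightarrow> real" where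
  "triple_sum \<tau> = fst \<tau> + fst (snd \<tau>) - snd (snd \<tau>)"

definition triple_phase :: "real \<times> real \<times> real \<Rightarrow> real" where
  "triple_phase \<tau> = (fst \<tau>)\<^sup>2 + (fst (snd \<tau>))\<^sup>2 - (snd (snd \<tau>))\<^sup>2"

definition triple_amp :: "(real \<Rightarrow> complex) \<Rightarrow> real \<times> real \<times> real \<Rightarrow> complex" where
  "triple_amp a \<tau> = a (fst \<tau>) * a (fst (snd \<tau>)) * cnj (a (snd (snd \<tau>)))"

lemma triple_phase_eq:
  "triple_phase \<tau> = (triple_sum \<tau>)\<^sup>2 - 2 * ((fst \<tau> - triple_sum \<tau>) * (fst (snd \<tau>) - triple_sum \<tau>))"
  by (simp add: triple_phase_def triple_sum_def power2_eq_square algebra_simps)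

lemma norm_sum_power2_le:
  fixes f :: "'a \<Rightarrow> complex"
  shows "(norm (sum f S))\<^sup>2 \<le> real (card S) * (\<Sum>x\<in>S. (norm (f x))\<^sup>2)"
proof -
  have "(norm (sum f S))\<^sup>2 \<le> (\<Sum>x\<in>S. 1 * norm (f x))\<^sup>2"
    by (simp add: norm_sum power_mono)
  also have "\<dots> \<le> (\<Sum>x\<in>S. 1\<^sup>2) * (\<Sum>x\<in>S. (norm (f x))\<^sup>2)"
    by (rule Cauchy_Schwarz_ineq_sum)
  finally show ?thesis by simp
qed

text \<open>The arithmetic input in abstract form: \<open>R\<close> bounds the multiplicity of a
  space-time frequency, \<open>\<delta>\<close> separates the temporal frequencies at fixed
  \<open>s\<close>, and \<open>\<delta> * Q\<close> bounds their spread. The phase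
  \<open>s\<^sup>2\<close> is exempt from the multiplicity bound because there the product of
  \<open>\<xi>\<^sub>1 - s\<close> and \<open>\<xi>\<^sub>2 - s\<close> is zero.\<close>

locale frequency_set =
  fixes X :: "real set" and a :: "real \<Rightarrow> complex" and R \<delta> :: real and Q :: nat
  assumes fin: "finite X" and R: "R \<ge> 0" and \<delta>: "\<delta> > 0" and Q: "Q > 0"
    and few: "\<And>s l. l \<noteq> s\<^sup>2 \<Longrightarrow>
      real (card {\<tau> \<in> X \<times> X \<times> X. triple_sum \<tau> = s \<and> triple_phase \<tau> = l}) \<le> R"
    and separated: "\<And>\<tau> \<tau>'. \<tau> \<in> X \<times> X \<times> X \<Longrightarrow> \<tau>' \<in> X \<times> X \<times> X \<Longrightarrow>
      triple_sum \<tau> = triple_sum \<tau>' \<Longrightarrow> triple_phase \<tau> \<noteq> triple_phase \<tau>' \<Longrightarrow>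
      \<delta> \<le> \<bar>triple_phase \<tau> - triple_phase \<tau>'\<bar> \<and> \<bar>triple_phase \<tau> - triple_phase \<tau>'\<bar> \<le> \<delta> * real Q"
begin

definition "triples = X \<times> X \<times> X"
definition "triples_at s = {\<tau> \<in> triples. triple_sum \<tau> = s}"
definition "energy = (\<Sum>\<xi>\<in>X. (norm (a \<xi>))\<^sup>2)"
text \<open>For \<open>u = solution\<close>, \<open>slice s t\<close> is the coefficient of
  \<open>u\<^sup>2 u\<^sup>*\<close> at spatial frequency \<open>s\<close>, and
  \<open>block s l\<close> is the coefficient of that slice at temporal frequency
  \<open>l\<close>.\<close>

definition "block s l = (\<Sum>\<tau> | \<tau> \<in> triples_at s \<and> triple_phase \<tau> = l. triple_amp a \<tau>)"
definition "slice s t = (\<Sum>l\<in>triple_phase ` triples_at s. block s l * cis (2 * pi * l * t))"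
definition "solution t x = (\<Sum>\<xi>\<in>X. a \<xi> * cis (2 * pi * (\<xi> * x + \<xi>\<^sup>2 * t)))"

lemma finite_triples [simp]: "finite triples" "finite (triples_at s)"
  using fin by (simp_all add: triples_def triples_at_def)

lemma energy_nonneg: "energy \<ge> 0"
  unfolding energy_def by (intro sum_nonneg) simp

lemma cubic_expansion:
  "solution t x * solution t x * cnj (solution t x)
    = (\<Sum>s\<in>triple_sum ` triples. slice s t * cis (2 * pi * s * x))"
proof -
  let ?e = "\<lambda>\<xi>. cis (2 * pi * (\<xi> * x + \<xi>\<^sup>2 * t))"
  let ?h = "\<lambda>\<tau>. triple_amp a \<tau> * cis (2 * pi * (triple_sum \<tau> * x + triple_phase \<tau> * t))"
  have "solution t x * solution t x * cnj (solution t x)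
    = (\<Sum>\<xi>\<in>X. a \<xi> * ?e \<xi>) * ((\<Sum>\<xi>\<in>X. a \<xi> * ?e \<xi>) * (\<Sum>\<xi>\<in>X. cnj (a \<xi> * ?e \<xi>)))"
    by (simp only: solution_def cnj_sum mult.assoc)
  also have "\<dots> = (\<Sum>\<xi>1\<in>X. \<Sum>\<xi>2\<in>X. \<Sum>\<xi>3\<in>X. (a \<xi>1 * ?e \<xi>1) * ((a \<xi>2 * ?e \<xi>2) * cnj (a \<xi>3 * ?e \<xi>3)))"
    by (simp only: sum_product) (simp only: sum_distrib_left)
  also have "\<dots> = (\<Sum>\<xi>1\<in>X. \<Sum>\<xi>2\<in>X. \<Sum>\<xi>3\<in>X. ?h (\<xi>1, \<xi>2, \<xi>3))"
  proof (intro sum.cong refl)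
    fix \<xi>1 \<xi>2 \<xi>3
    have "?e \<xi>1 * ?e \<xi>2 * cnj (?e \<xi>3)
      = cis (2 * pi * (triple_sum (\<xi>1, \<xi>2, \<xi>3) * x + triple_phase (\<xi>1, \<xi>2, \<xi>3) * t))"
      unfolding cis_cnj cis_mult by (simp add: triple_sum_def triple_phase_def algebra_simps)
    then show "(a \<xi>1 * ?e \<xi>1) * ((a \<xi>2 * ?e \<xi>2) * cnj (a \<xi>3 * ?e \<xi>3)) = ?h (\<xi>1, \<xi>2, \<xi>3)"
      by (simp add: triple_amp_def mult_ac)
  qed
  also have "\<dots> = (\<Sum>\<tau>\<in>triples. ?h \<tau>)"
    by (simp add: triples_def sum.cartesian_product)
  also have "\<dots> = (\<Sum>s\<in>triple_sum ` triples. \<Sum>\<tau>\<in>triples_at s. ?h \<tau>)"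
    unfolding triples_at_def by (rule sum.image_gen) simp
  also have "\<dots> = (\<Sum>s\<in>triple_sum ` triples. slice s t * cis (2 * pi * s * x))"
  proof (intro sum.cong refl)
    fix s
    have "(\<Sum>\<tau>\<in>triples_at s. ?h \<tau>)
      = (\<Sum>l\<in>triple_phase ` triples_at s. \<Sum>\<tau> | \<tau> \<in> triples_at s \<and> triple_phase \<tau> = l. ?h \<tau>)"
      by (rule sum.image_gen) simp
    also have "\<dots> = (\<Sum>l\<in>triple_phase ` triples_at s. block s l * cis (2 * pi * l * t) * cis (2 * pi * s * x))"
      unfolding block_def sum_distrib_right
    proof (intro sum.cong refl)
      fix l \<tau> assume "\<tau> \<in> {\<tau> \<in> triples_at s. triple_phase \<tau> = l}"
      then have "triple_sum \<tau> = s" "triple_phase \<tau> = l" by (auto simp: triples_at_def)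
      then show "?h \<tau> = triple_amp a \<tau> * cis (2 * pi * l * t) * cis (2 * pi * s * x)"
        by (simp add: cis_mult algebra_simps)
    qed
    finally show "(\<Sum>\<tau>\<in>triples_at s. ?h \<tau>) = slice s t * cis (2 * pi * s * x)"
      by (simp add: slice_def sum_distrib_right)
  qed
  finally show ?thesis .
qed

lemma sum_amp: "(\<Sum>\<tau>\<in>triples. (norm (triple_amp a \<tau>))\<^sup>2) = energy ^ 3"
proof -
  have "energy ^ 3 = energy * (energy * energy)" by (simp add: power3_eq_cube)
  also have "\<dots> = (\<Sum>x\<in>X. \<Sum>y\<in>X. \<Sum>z\<in>X. (norm (a x))\<^sup>2 * ((norm (a y))\<^sup>2 * (norm (a z))\<^sup>2))"
    unfolding energy_def by (simp only: sum_product) (simp only: sum_distrib_left)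
  also have "\<dots> = (\<Sum>\<tau>\<in>triples. (norm (triple_amp a \<tau>))\<^sup>2)"
    by (simp add: triples_def sum.cartesian_product triple_amp_def norm_mult power_mult_distrib
        case_prod_beta mult_ac)
  finally show ?thesis ..
qed

text \<open>The phase \<open>s\<^sup>2\<close> is attained exactly by the triples \<open>(s, \<xi>, \<xi>)\<close> and \<open>(\<xi>, s, \<xi>)\<close>.\<close>

lemma degenerate_block_le:
  "(norm (block s (s\<^sup>2)))\<^sup>2 \<le> (if s \<in> X then 4 * (norm (a s))\<^sup>2 * energy\<^sup>2 else 0)"
proof -
  let ?S = "{\<tau> \<in> triples_at s. triple_phase \<tau> = s\<^sup>2}"
  have deg: "fst \<tau> = s \<and> fst (snd \<tau>) = snd (snd \<tau>) \<or> fst (snd \<tau>) = s \<and> fst \<tau> = snd (snd \<tau>)"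
    if "\<tau> \<in> ?S" for \<tau>
  proof -
    have s: "triple_sum \<tau> = s" "triple_phase \<tau> = s\<^sup>2" using that by (auto simp: triples_at_def)
    then have "(fst \<tau> - s) * (fst (snd \<tau>) - s) = 0"
      using triple_phase_eq[of \<tau>] by simp
    then show ?thesis using s(1) by (auto simp: triple_sum_def)
  qed
  show ?thesis
  proof (cases "s \<in> X")
    case False
    then have "?S = {}" using deg by (fastforce simp: triples_at_def triples_def)
    then show ?thesis using False by (simp add: block_def del: Collect_empty_eq)
  next
    case True
    let ?A = "(\<lambda>\<xi>. (s, \<xi>, \<xi>)) ` X" and ?B = "(\<lambda>\<xi>. (\<xi>, s, \<xi>)) ` X"
    have "?S \<subseteq> ?A \<union> ?B"
    proof
      fix \<tau> assume \<tau>: "\<tau> \<in> ?S"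
      then have "fst \<tau> \<in> X" "fst (snd \<tau>) \<in> X" by (auto simp: triples_at_def triples_def)
      with deg[OF \<tau>] show "\<tau> \<in> ?A \<union> ?B"
        by (cases \<tau>) auto
    qed
    have inj: "inj_on (\<lambda>\<xi>. (s, \<xi>, \<xi>)) X" "inj_on (\<lambda>\<xi>. (\<xi>, s, \<xi>)) X"
      by (auto simp: inj_on_def)
    have "norm (block s (s\<^sup>2)) \<le> (\<Sum>\<tau>\<in>?S. norm (triple_amp a \<tau>))"
      unfolding block_def by (rule norm_sum)
    also have "\<dots> \<le> (\<Sum>\<tau>\<in>?A \<union> ?B. norm (triple_amp a \<tau>))"
      using \<open>?S \<subseteq> ?A \<union> ?B\<close> fin by (intro sum_mono2) auto
    also have "\<dots> \<le> (\<Sum>\<tau>\<in>?A. norm (triple_amp a \<tau>)) + (\<Sum>\<tau>\<in>?B. norm (triple_amp a \<tau>))"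
      using fin sum_nonneg[of "?A \<inter> ?B" "\<lambda>\<tau>. norm (triple_amp a \<tau>)"] by (simp add: sum_Un)
    also have "\<dots> = norm (a s) * energy + norm (a s) * energy"
      unfolding sum.reindex[OF inj(1)] sum.reindex[OF inj(2)] energy_def sum_distrib_left
      by (simp add: triple_amp_def norm_mult power2_eq_square mult_ac)
    finally have "norm (block s (s\<^sup>2)) \<le> 2 * (norm (a s) * energy)" by (simp add: mult_ac)
    then have "(norm (block s (s\<^sup>2)))\<^sup>2 \<le> (2 * (norm (a s) * energy))\<^sup>2"
      by (rule power_mono) simp
    then show ?thesis using True by (simp add: power_mult_distrib)
  qed
qed

text \<open>Cauchy-Schwarz over at most \<open>R\<close> triples treats the phases other than
  \<open>s\<^sup>2\<close> and yields \<open>R * energy ^ 3\<close>. The blocks at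
  \<open>s\<^sup>2\<close> can have many triples, but their squares are at most
  \<open>4 * (norm (a s))\<^sup>2 * energy\<^sup>2\<close> and there is one for each
  \<open>s\<close>.\<close>

lemma sum_block_le:
  "(\<Sum>s\<in>triple_sum ` triples. \<Sum>l\<in>triple_phase ` triples_at s. (norm (block s l))\<^sup>2)
    \<le> (4 + R) * energy ^ 3"
proof -
  let ?d = "\<lambda>s. if s \<in> X then 4 * (norm (a s))\<^sup>2 * energy\<^sup>2 else 0"
  let ?m = "\<lambda>s l. \<Sum>\<tau> | \<tau> \<in> triples_at s \<and> triple_phase \<tau> = l. (norm (triple_amp a \<tau>))\<^sup>2"
  have m0: "?m s l \<ge> 0" for s l by (intro sum_nonneg) simp
  have d0: "?d s \<ge> 0" for s by simp
  have one: "(norm (block s l))\<^sup>2 \<le> (if l = s\<^sup>2 then ?d s else 0) + R * ?m s l" for s l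
  proof (cases "l = s\<^sup>2")
    case True
    then show ?thesis
      using degenerate_block_le[of s] mult_nonneg_nonneg[OF R m0[of s l]] by auto
  next
    case False
    have "{\<tau> \<in> triples_at s. triple_phase \<tau> = l} = {\<tau> \<in> X \<times> X \<times> X. triple_sum \<tau> = s \<and> triple_phase \<tau> = l}"
      by (auto simp: triples_at_def triples_def)
    then have "real (card {\<tau> \<in> triples_at s. triple_phase \<tau> = l}) \<le> R"
      using few[OF False] by simp
    then have "real (card {\<tau> \<in> triples_at s. triple_phase \<tau> = l}) * ?m s l \<le> R * ?m s l"
      using m0 by (rule mult_right_mono)
    then show ?thesis
      using norm_sum_power2_le[of "triple_amp a" "{\<tau> \<in> triples_at s. triple_phase \<tau> = l}"] False
      by (simp add: block_def)
  qed
  have "(\<Sum>l\<in>triple_phase ` triples_at s. (norm (block s l))\<^sup>2)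
      \<le> ?d s + R * (\<Sum>\<tau>\<in>triples_at s. (norm (triple_amp a \<tau>))\<^sup>2)" for s
  proof -
    have "(\<Sum>l\<in>triple_phase ` triples_at s. (norm (block s l))\<^sup>2)
      \<le> (\<Sum>l\<in>triple_phase ` triples_at s. (if l = s\<^sup>2 then ?d s else 0) + R * ?m s l)"
      by (intro sum_mono one)
    also have "\<dots> = (\<Sum>l\<in>triple_phase ` triples_at s. if l = s\<^sup>2 then ?d s else 0)
        + R * (\<Sum>l\<in>triple_phase ` triples_at s. ?m s l)"
      by (simp only: sum.distrib sum_distrib_left)
    also have "(\<Sum>l\<in>triple_phase ` triples_at s. ?m s l) = (\<Sum>\<tau>\<in>triples_at s. (norm (triple_amp a \<tau>))\<^sup>2)"
      by (rule sum.image_gen[symmetric]) simp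
    also have "(\<Sum>l\<in>triple_phase ` triples_at s. if l = s\<^sup>2 then ?d s else 0) \<le> ?d s"
      using d0[of s] by (subst sum.delta) auto
    finally show ?thesis by simp
  qed
  then have "(\<Sum>s\<in>triple_sum ` triples. \<Sum>l\<in>triple_phase ` triples_at s. (norm (block s l))\<^sup>2)
    \<le> (\<Sum>s\<in>triple_sum ` triples. ?d s + R * (\<Sum>\<tau>\<in>triples_at s. (norm (triple_amp a \<tau>))\<^sup>2))"
    by (rule sum_mono)
  also have "\<dots> = (\<Sum>s\<in>triple_sum ` triples. ?d s)
      + R * (\<Sum>s\<in>triple_sum ` triples. \<Sum>\<tau>\<in>triples_at s. (norm (triple_amp a \<tau>))\<^sup>2)"
    by (simp only: sum.distrib sum_distrib_left)
  also have "(\<Sum>s\<in>triple_sum ` triples. \<Sum>\<tau>\<in>triples_at s. (norm (triple_amp a \<tau>))\<^sup>2) = energy ^ 3"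
    unfolding triples_at_def sum_amp[symmetric] by (rule sum.image_gen[symmetric]) simp
  also have "(\<Sum>s\<in>triple_sum ` triples. ?d s) \<le> 4 * energy ^ 3"
  proof -
    have "(\<Sum>s\<in>triple_sum ` triples. ?d s) \<le> (\<Sum>s\<in>triple_sum ` triples \<union> X. ?d s)"
      using fin by (intro sum_mono2) auto
    also have "\<dots> = (\<Sum>s\<in>X. 4 * (norm (a s))\<^sup>2 * energy\<^sup>2)"
      using fin by (intro sum.mono_neutral_cong_right) auto
    also have "\<dots> = 4 * (\<Sum>s\<in>X. (norm (a s))\<^sup>2) * energy\<^sup>2"
      by (simp only: sum_distrib_left sum_distrib_right)
    finally have "(\<Sum>s\<in>triple_sum ` triples. ?d s) \<le> 4 * energy * energy\<^sup>2"
      by (simp only: energy_def[symmetric])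
    then show ?thesis by (simp add: power3_eq_cube power2_eq_square)
  qed
  finally show ?thesis by (simp add: distrib_right)
qed

text \<open>The large sieve is applied to each slice separately, so the phases have to be separated
  only among triples with the same sum.\<close>

lemma nn_integral_slices_le:
  assumes T: "T \<ge> 0"
  shows "(\<integral>\<^sup>+t\<in>{0..T}. ennreal (\<Sum>s\<in>triple_sum ` triples. (norm (slice s t))\<^sup>2) \<partial>lborel)
    \<le> ennreal ((T + 2 * (1 + ln (real Q)) / \<delta>) * ((4 + R) * energy ^ 3))"
proof -
  let ?G = "T + 2 * (1 + ln (real Q)) / \<delta>"
  have G: "?G \<ge> 0" using T Q \<delta> by simp
  have "(\<integral>\<^sup>+t\<in>{0..T}. ennreal (\<Sum>s\<in>triple_sum ` triples. (norm (slice s t))\<^sup>2) \<partial>lborel)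
    = (\<Sum>s\<in>triple_sum ` triples. \<integral>\<^sup>+t\<in>{0..T}. ennreal ((norm (slice s t))\<^sup>2) \<partial>lborel)"
  proof -
    have meas: "(\<lambda>t. ennreal ((norm (slice s t))\<^sup>2) * indicator {0..T} t) \<in> borel_measurable lborel" for s
    proof -
      have "continuous_on UNIV (\<lambda>t. (norm (slice s t))\<^sup>2)"
        unfolding slice_def by (intro continuous_intros)
      then have "(\<lambda>t. (norm (slice s t))\<^sup>2) \<in> borel_measurable borel"
        by (rule borel_measurable_continuous_onI)
      then show ?thesis by simp
    qed
    have "ennreal (\<Sum>s\<in>triple_sum ` triples. (norm (slice s t))\<^sup>2) * indicator {0..T} t
        = (\<Sum>s\<in>triple_sum ` triples. ennreal ((norm (slice s t))\<^sup>2) * indicator {0..T} t)" for t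
      by (subst sum_ennreal[symmetric]) (simp_all only: zero_le_power2 sum_distrib_right)
    then show ?thesis
      by (simp only: nn_integral_sum[OF meas])
  qed
  also have "\<dots> \<le> (\<Sum>s\<in>triple_sum ` triples. ennreal (?G * (\<Sum>l\<in>triple_phase ` triples_at s. (norm (block s l))\<^sup>2)))"
  proof (rule sum_mono)
    fix s
    show "(\<integral>\<^sup>+t\<in>{0..T}. ennreal ((norm (slice s t))\<^sup>2) \<partial>lborel)
      \<le> ennreal (?G * (\<Sum>l\<in>triple_phase ` triples_at s. (norm (block s l))\<^sup>2))"
      unfolding slice_def
    proof (rule large_sieve[OF _ \<delta> Q T])
      fix l l' assume "l \<in> triple_phase ` triples_at s" "l' \<in> triple_phase ` triples_at s" "l \<noteq> l'"
      then show "\<delta> \<le> \<bar>l - l'\<bar> \<and> \<bar>l - l'\<bar> \<le> \<delta> * real Q"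
        using separated by (auto simp: triples_at_def triples_def)
    qed simp
  qed
  also have "\<dots> = ennreal (?G * (\<Sum>s\<in>triple_sum ` triples. \<Sum>l\<in>triple_phase ` triples_at s. (norm (block s l))\<^sup>2))"
    using G unfolding sum_distrib_left[of ?G "\<lambda>s. \<Sum>l\<in>triple_phase ` triples_at s. (norm (block s l))\<^sup>2"]
    by (intro sum_ennreal mult_nonneg_nonneg sum_nonneg) auto
  also have "\<dots> \<le> ennreal (?G * ((4 + R) * energy ^ 3))"
    using G sum_block_le by (intro ennreal_leI mult_left_mono)
  finally show ?thesis .
qed

end


section \<open>From the sixth moment to the exponent p\<close>

lemma ennreal_powr_inverse:
  assumes "p > 0"
  shows "ennreal_powr (ennreal_powr x (1 / p)) p = x"
proof (cases x)
  case (real r)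
  then show ?thesis using assms by (simp add: ennreal_powr_def powr_powr)
next
  case top
  then show ?thesis by (simp add: ennreal_powr_def)
qed

lemma ennreal_powr_le:
  assumes "x \<le> ennreal r" "r \<ge> 0" "q > 0"
  shows "ennreal_powr x q \<le> ennreal (r powr q)"
proof (cases x)
  case (real s)
  then show ?thesis using assms by (auto simp: ennreal_powr_def intro!: ennreal_leI powr_mono2)
next
  case top
  then show ?thesis using assms by (simp add: top_unique)
qed

context frequency_set
begin

lemma norm_solution_le: "norm (solution t x) \<le> sqrt (real (card X) * energy)"
proof (rule real_le_rsqrt)
  have "(norm (solution t x))\<^sup>2 \<le> real (card X) *
      (\<Sum>\<xi>\<in>X. (norm (a \<xi> * cis (2 * pi * (\<xi> * x + \<xi>\<^sup>2 * t))))\<^sup>2)"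
    unfolding solution_def by (rule norm_sum_power2_le)
  then show "(norm (solution t x))\<^sup>2 \<le> real (card X) * energy"
    by (simp add: norm_mult energy_def)
qed

lemma norm_solution_powr_le:
  assumes "p \<ge> 6"
  shows "norm (solution t x) powr p \<le>
    sqrt (real (card X) * energy) powr (p - 6) * (norm (solution t x * solution t x * cnj (solution t x)))\<^sup>2"
proof (cases "solution t x = 0")
  case False
  let ?v = "norm (solution t x)"
  have "?v powr p = ?v powr (p - 6) * ?v powr 6"
    by (metis powr_add diff_add_cancel)
  also have "?v powr 6 = (?v * ?v * ?v)\<^sup>2"
    using False by (simp add: powr_numeral power2_eq_square eval_nat_numeral)
  also have "?v powr (p - 6) * (?v * ?v * ?v)\<^sup>2
    \<le> sqrt (real (card X) * energy) powr (p - 6) * (?v * ?v * ?v)\<^sup>2"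
    using assms norm_solution_le by (intro mult_right_mono powr_mono2) auto
  finally show ?thesis by (simp add: norm_mult)
qed simp

lemma mean_norm_solution_le:
  assumes "p \<ge> 6"
  shows "ennreal_powr (mean_norm p (solution t)) p \<le>
    ennreal (sqrt (real (card X) * energy) powr (p - 6)) * ennreal (\<Sum>s\<in>triple_sum ` triples. (norm (slice s t))\<^sup>2)"
proof -
  define N where "N = sqrt (real (card X) * energy) powr (p - 6)"
  have N: "N \<ge> 0" by (simp add: N_def)
  have "ennreal_powr (mean_norm p (solution t)) p
    = Limsup at_top (\<lambda>L :: real. (\<integral>\<^sup>+x\<in>{-L..L}. ennreal (norm (solution t x) powr p) \<partial>lborel) / ennreal (2 * L))"
    unfolding mean_norm_def using assms by (intro ennreal_powr_inverse) simp
  \<comment> \<open>The constant weight from the sup bound enters the coefficients as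
    \<open>sqrt N\<close>, so that the dominating function is again the square of a trigonometric
    sum.\<close>
  also have "\<dots> \<le> ennreal (\<Sum>s\<in>triple_sum ` triples. (norm (of_real (sqrt N) * slice s t))\<^sup>2)"
  proof (rule Limsup_mean_le)
    fix x
    have "(\<Sum>s\<in>triple_sum ` triples. of_real (sqrt N) * slice s t * cis (2 * pi * s * x))
      = of_real (sqrt N) * (solution t x * solution t x * cnj (solution t x))"
      unfolding cubic_expansion by (simp only: sum_distrib_left mult.assoc)
    then show "norm (solution t x) powr p \<le> (norm (\<Sum>s\<in>triple_sum ` triples. of_real (sqrt N) * slice s t * cis (2 * pi * s * x)))\<^sup>2"
      using norm_solution_powr_le[OF assms, of t x] N
      by (simp only: norm_mult norm_of_real power_mult_distrib power2_abs real_sqrt_pow2 N_def[symmetric])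
  qed simp
  also have "(\<Sum>s\<in>triple_sum ` triples. (norm (of_real (sqrt N) * slice s t))\<^sup>2)
      = N * (\<Sum>s\<in>triple_sum ` triples. (norm (slice s t))\<^sup>2)"
    unfolding norm_mult norm_of_real power_mult_distrib power2_abs real_sqrt_pow2[OF N] sum_distrib_left ..
  finally show ?thesis
    using N by (simp only: ennreal_mult' N_def)
qed

lemma mixed_norm_solution_le:
  assumes p: "p \<ge> 6" and T: "T \<ge> 0"
  shows "mixed_norm p T solution \<le> ennreal ((real (card X) powr ((p - 6) / 2)
    * ((T + 2 * (1 + ln (real Q)) / \<delta>) * (4 + R))) powr (1 / p) * sqrt energy)"
proof -
  define N where "N = sqrt (real (card X) * energy) powr (p - 6)"
  define G where "G = (T + 2 * (1 + ln (real Q)) / \<delta>) * (4 + R)"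
  have G: "G \<ge> 0" using T Q \<delta> R by (simp add: G_def)
  have N: "N \<ge> 0" by (simp add: N_def)
  have meas: "(\<lambda>t. ennreal (\<Sum>s\<in>triple_sum ` triples. (norm (slice s t))\<^sup>2) * indicator {0..T} t) \<in> borel_measurable lborel"
  proof -
    have "continuous_on UNIV (\<lambda>t. \<Sum>s\<in>triple_sum ` triples. (norm (slice s t))\<^sup>2)"
      unfolding slice_def by (intro continuous_intros)
    then have "(\<lambda>t. \<Sum>s\<in>triple_sum ` triples. (norm (slice s t))\<^sup>2) \<in> borel_measurable borel"
      by (rule borel_measurable_continuous_onI)
    then show ?thesis by simp
  qed
  have "(\<integral>\<^sup>+t\<in>{0..T}. ennreal_powr (mean_norm p (solution t)) p \<partial>lborel)
    \<le> (\<integral>\<^sup>+t. ennreal N * (ennreal (\<Sum>s\<in>triple_sum ` triples. (norm (slice s t))\<^sup>2) * indicator {0..T} t) \<partial>lborel)"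
    using mean_norm_solution_le[OF p]
    by (intro nn_integral_mono) (simp add: N_def mult.assoc[symmetric] mult_right_mono)
  also have "\<dots> = ennreal N * (\<integral>\<^sup>+t\<in>{0..T}. ennreal (\<Sum>s\<in>triple_sum ` triples. (norm (slice s t))\<^sup>2) \<partial>lborel)"
    by (rule nn_integral_cmult[OF meas])
  also have "\<dots> \<le> ennreal N * ennreal ((T + 2 * (1 + ln (real Q)) / \<delta>) * ((4 + R) * energy ^ 3))"
    by (intro mult_left_mono nn_integral_slices_le T) simp
  also have "\<dots> = ennreal (N * (G * energy ^ 3))"
    using N by (simp only: ennreal_mult'[symmetric] G_def mult.assoc)
  finally have "mixed_norm p T solution \<le> ennreal ((N * (G * energy ^ 3)) powr (1 / p))"
    unfolding mixed_norm_def using N G energy_nonneg p by (intro ennreal_powr_le) auto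
  \<comment> \<open>The energy occurs with exponent \<open>(p - 6) / 2\<close> from the sup bound
    and 3 from the sixth moment, altogether \<open>p / 2\<close>, whose \<open>p\<close>-th root is
    \<open>sqrt energy\<close>.\<close>
  also have "(N * (G * energy ^ 3)) powr (1 / p) = (real (card X) powr ((p - 6) / 2) * G) powr (1 / p) * sqrt energy"
  proof (cases "energy = 0")
    case False
    then have E: "energy > 0" using energy_nonneg by simp
    have "N = (real (card X) * energy) powr ((p - 6) / 2)"
      using E by (simp add: N_def powr_half_sqrt[symmetric] powr_powr)
    also have "\<dots> = real (card X) powr ((p - 6) / 2) * energy powr ((p - 6) / 2)"
      using E by (simp add: powr_mult)
    finally have "N * (G * energy ^ 3)
      = (real (card X) powr ((p - 6) / 2) * G) * (energy powr ((p - 6) / 2) * energy powr 3)"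
      using E by (simp add: powr_numeral)
    also have "energy powr ((p - 6) / 2) * energy powr 3 = energy powr (p / 2)"
      by (simp add: powr_add[symmetric] diff_divide_distrib)
    finally have eq: "N * (G * energy ^ 3) = (real (card X) powr ((p - 6) / 2) * G) * energy powr (p / 2)" .
    have "(N * (G * energy ^ 3)) powr (1 / p)
      = (real (card X) powr ((p - 6) / 2) * G) powr (1 / p) * (energy powr (p / 2)) powr (1 / p)"
      unfolding eq by (rule powr_mult)
    also have "(energy powr (p / 2)) powr (1 / p) = sqrt energy"
      using E p by (simp add: powr_powr powr_half_sqrt)
    finally show ?thesis .
  qed simp
  finally show ?thesis by (simp only: G_def)
qed

end

text \<open>The differences \<open>\<xi>\<^sub>1 - s\<close> and \<open>\<xi>\<^sub>2 - s\<close>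
  have height at most \<open>2 * C\<close>, so a triple with given \<open>s\<close> and phase yields
  a factorization of \<open>(s\<^sup>2 - l) / 2\<close> in the doubled box. The predicate takes
  \<open>X\<close>, \<open>R\<close>, \<open>\<delta>\<close> and \<open>Q\<close>; the coefficients
  enter only on interpretation, so the constants are uniform in them.\<close>

lemma quadratic_frequency_set:
  assumes \<omega>: "algebraic \<omega>" "alg_degree \<omega> = 2" "\<omega> \<notin> \<rat>" and \<eta>: "\<eta> > 0"
  shows "\<exists>K>0. \<exists>c>0. \<forall>C\<ge>1. \<forall>X \<subseteq> quadratic_emb \<omega> ` int_pair_box C.
    frequency_set X (K * C powr \<eta>) (c / C\<^sup>2) (Suc (nat \<lceil>4 * (C * (1 + \<bar>\<omega>\<bar>))\<^sup>2 / (c / C\<^sup>2)\<rceil>))"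
proof -
  obtain K where K: "K > 0" "\<And>C M. C \<ge> 1 \<Longrightarrow> M \<noteq> 0 \<Longrightarrow>
    real (card {(z, w). z \<in> int_pair_box C \<and> w \<in> int_pair_box C
      \<and> quadratic_emb \<omega> z * quadratic_emb \<omega> w = M}) \<le> K * C powr \<eta>"
    using card_factorizations_quadratic_irrational[OF \<omega> \<eta>] by auto
  obtain c where c: "c > 0" "\<And>C z w z' w'. C \<ge> 1 \<Longrightarrow> z \<in> int_pair_box C \<Longrightarrow> w \<in> int_pair_box C \<Longrightarrow>
    z' \<in> int_pair_box C \<Longrightarrow> w' \<in> int_pair_box C \<Longrightarrow>
    quadratic_emb \<omega> z * quadratic_emb \<omega> w \<noteq> quadratic_emb \<omega> z' * quadratic_emb \<omega> w' \<Longrightarrow>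
    c / C\<^sup>2 \<le> \<bar>quadratic_emb \<omega> z * quadratic_emb \<omega> w - quadratic_emb \<omega> z' * quadratic_emb \<omega> w'\<bar>"
    using products_separated_quadratic_irrational[OF \<omega>] by metis
  have inj: "inj (quadratic_emb \<omega>)" by (rule inj_quadratic_emb[OF \<omega>(3)])
  \<comment> \<open>The factor \<open>2 powr \<eta>\<close> comes from the doubled box. In
    \<open>c / 2\<close> the doubled box contributes a quarter, and the factor 2 in front of the
    product in the phase gives back a half.\<close>
  have "frequency_set X ((K * 2 powr \<eta>) * C powr \<eta>) ((c / 2) / C\<^sup>2)
      (Suc (nat \<lceil>4 * (C * (1 + \<bar>\<omega>\<bar>))\<^sup>2 / ((c / 2) / C\<^sup>2)\<rceil>))"
    if C: "C \<ge> 1" and X: "X \<subseteq> quadratic_emb \<omega> ` int_pair_box C" for C X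
  proof
    define P where "P = inv (quadratic_emb \<omega>)"
    have P: "P \<xi> \<in> int_pair_box C" "quadratic_emb \<omega> (P \<xi>) = \<xi>" if "\<xi> \<in> X" for \<xi>
      using that X inj by (auto simp: P_def)
    \<comment> \<open>With \<open>s = \<xi>\<^sub>1 + \<xi>\<^sub>2 - \<xi>\<^sub>3\<close> one has
      \<open>\<xi>\<^sub>1 - s = \<xi>\<^sub>3 - \<xi>\<^sub>2\<close> and
      \<open>\<xi>\<^sub>2 - s = \<xi>\<^sub>3 - \<xi>\<^sub>1\<close>, which avoids inverting the
      embedding at \<open>s\<close>.\<close>
    define V where "V \<tau> = (P (snd (snd \<tau>)) - P (fst (snd \<tau>)), P (snd (snd \<tau>)) - P (fst \<tau>))" for \<tau>
    have V: "fst (V \<tau>) \<in> int_pair_box (2 * C)" "snd (V \<tau>) \<in> int_pair_box (2 * C)"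
      "quadratic_emb \<omega> (fst (V \<tau>)) = fst \<tau> - triple_sum \<tau>"
      "quadratic_emb \<omega> (snd (V \<tau>)) = fst (snd \<tau>) - triple_sum \<tau>"
      if "\<tau> \<in> X \<times> X \<times> X" for \<tau>
    proof -
      have \<tau>: "fst \<tau> \<in> X" "fst (snd \<tau>) \<in> X" "snd (snd \<tau>) \<in> X" using that by auto
      show "fst (V \<tau>) \<in> int_pair_box (2 * C)" "snd (V \<tau>) \<in> int_pair_box (2 * C)"
        using P(1)[OF \<tau>(1)] P(1)[OF \<tau>(2)] P(1)[OF \<tau>(3)] by (auto simp: int_pair_box_def V_def)
      show "quadratic_emb \<omega> (fst (V \<tau>)) = fst \<tau> - triple_sum \<tau>"
        "quadratic_emb \<omega> (snd (V \<tau>)) = fst (snd \<tau>) - triple_sum \<tau>"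
        using P(2)[OF \<tau>(1)] P(2)[OF \<tau>(2)] P(2)[OF \<tau>(3)]
        by (simp_all add: V_def triple_sum_def flip: quadratic_emb_diff)
    qed
    have phase: "triple_phase \<tau> = (triple_sum \<tau>)\<^sup>2 - 2 * (quadratic_emb \<omega> (fst (V \<tau>)) * quadratic_emb \<omega> (snd (V \<tau>)))"
      if "\<tau> \<in> X \<times> X \<times> X" for \<tau>
      using triple_phase_eq[of \<tau>] by (simp add: V[OF that])
    show "finite X" by (rule finite_subset[OF X finite_imageI[OF finite_int_pair_box]])
    show "0 \<le> K * 2 powr \<eta> * C powr \<eta>" using K by simp
    show "0 < c / 2 / C\<^sup>2" using c C by simp
    show "0 < Suc (nat \<lceil>4 * (C * (1 + \<bar>\<omega>\<bar>))\<^sup>2 / (c / 2 / C\<^sup>2)\<rceil>)" by simp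
    show "real (card {\<tau> \<in> X \<times> X \<times> X. triple_sum \<tau> = s \<and> triple_phase \<tau> = l}) \<le> K * 2 powr \<eta> * C powr \<eta>"
      if "l \<noteq> s\<^sup>2" for s l
    proof -
      let ?S = "{\<tau> \<in> X \<times> X \<times> X. triple_sum \<tau> = s \<and> triple_phase \<tau> = l}"
      let ?S' = "{(z, w). z \<in> int_pair_box (2 * C) \<and> w \<in> int_pair_box (2 * C)
        \<and> quadratic_emb \<omega> z * quadratic_emb \<omega> w = (s\<^sup>2 - l) / 2}"
      have "inj_on V ?S"
      proof (rule inj_onI)
        fix \<tau> \<tau>' assume \<tau>: "\<tau> \<in> ?S" "\<tau>' \<in> ?S" "V \<tau> = V \<tau>'"
        then have in_triples: "\<tau> \<in> X \<times> X \<times> X" "\<tau>' \<in> X \<times> X \<times> X"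
          and s: "triple_sum \<tau> = s" "triple_sum \<tau>' = s" by blast+
        have "fst \<tau> - s = fst \<tau>' - s" "fst (snd \<tau>) - s = fst (snd \<tau>') - s"
          using V(3,4)[OF in_triples(1)] V(3,4)[OF in_triples(2)] \<tau>(3) s by metis+
        moreover have "fst \<tau> + fst (snd \<tau>) - snd (snd \<tau>) = fst \<tau>' + fst (snd \<tau>') - snd (snd \<tau>')"
          using \<tau>(1,2) by (simp add: triple_sum_def)
        ultimately show "\<tau> = \<tau>'" by (simp add: prod_eq_iff)
      qed
      moreover have "V ` ?S \<subseteq> ?S'"
      proof
        fix v assume "v \<in> V ` ?S"
        then obtain \<tau> where \<tau>: "\<tau> \<in> X \<times> X \<times> X" "triple_sum \<tau> = s" "triple_phase \<tau> = l" "v = V \<tau>"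
          by blast
        then have "quadratic_emb \<omega> (fst v) * quadratic_emb \<omega> (snd v) = (s\<^sup>2 - l) / 2"
          using phase[OF \<tau>(1)] by simp
        then show "v \<in> ?S'" using V(1,2)[OF \<tau>(1)] \<tau>(4) by (simp add: case_prod_beta)
      qed
      moreover have "finite ?S'"
        by (rule finite_subset[of _ "int_pair_box (2 * C) \<times> int_pair_box (2 * C)"]) auto
      ultimately have "card ?S \<le> card ?S'" by (rule card_inj_on_le)
      \<comment> \<open>Here \<open>l \<noteq> s\<^sup>2\<close> guarantees that the element being
        factored is nonzero.\<close>
      also have "real (card ?S') \<le> K * (2 * C) powr \<eta>"
        using that C by (intro K(2)) auto
      also have "\<dots> = K * 2 powr \<eta> * C powr \<eta>" using C by (simp add: powr_mult)
      finally show ?thesis by simp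
    qed
    fix \<tau> \<tau>' assume \<tau>: "\<tau> \<in> X \<times> X \<times> X" "\<tau>' \<in> X \<times> X \<times> X"
      and s: "triple_sum \<tau> = triple_sum \<tau>'" and l: "triple_phase \<tau> \<noteq> triple_phase \<tau>'"
    have "c / (2 * C)\<^sup>2 \<le> \<bar>quadratic_emb \<omega> (fst (V \<tau>)) * quadratic_emb \<omega> (snd (V \<tau>))
        - quadratic_emb \<omega> (fst (V \<tau>')) * quadratic_emb \<omega> (snd (V \<tau>'))\<bar>"
      using C V(1,2)[OF \<tau>(1)] V(1,2)[OF \<tau>(2)] l s phase[OF \<tau>(1)] phase[OF \<tau>(2)]
      by (intro c(2)) auto
    moreover have "triple_phase \<tau> - triple_phase \<tau>' = - 2 * (quadratic_emb \<omega> (fst (V \<tau>)) * quadratic_emb \<omega> (snd (V \<tau>))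
        - quadratic_emb \<omega> (fst (V \<tau>')) * quadratic_emb \<omega> (snd (V \<tau>')))"
      using s phase[OF \<tau>(1)] phase[OF \<tau>(2)] by simp
    ultimately have lower: "c / 2 / C\<^sup>2 \<le> \<bar>triple_phase \<tau> - triple_phase \<tau>'\<bar>"
      by (simp add: abs_mult power_mult_distrib)
    let ?H = "C * (1 + \<bar>\<omega>\<bar>)"
    have sq: "\<xi>\<^sup>2 \<le> ?H\<^sup>2" if "\<xi> \<in> X" for \<xi>
    proof -
      have "\<bar>\<xi>\<bar> \<le> ?H" using quadratic_emb_bound[of _ C \<omega>] X that by auto
      then show ?thesis by (metis abs_ge_zero power2_abs power_mono)
    qed
    \<comment> \<open>Two phases differ by at most \<open>4 * ?H\<^sup>2\<close>; dividing by the
      separation and rounding up gives the value of \<open>Q\<close>, where \<open>Suc\<close> also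
      ensures positivity.\<close>
    have phase_bound: "\<bar>triple_phase \<sigma>\<bar> \<le> 2 * ?H\<^sup>2" if "\<sigma> \<in> X \<times> X \<times> X" for \<sigma>
    proof -
      have "fst \<sigma> \<in> X" "fst (snd \<sigma>) \<in> X" "snd (snd \<sigma>) \<in> X" using that by auto
      from sq[OF this(1)] sq[OF this(2)] sq[OF this(3)] show ?thesis
        unfolding triple_phase_def abs_le_iff
        using zero_le_power2[of "fst \<sigma>"] zero_le_power2[of "fst (snd \<sigma>)"] zero_le_power2[of "snd (snd \<sigma>)"]
        by linarith
    qed
    have "\<bar>triple_phase \<tau> - triple_phase \<tau>'\<bar> \<le> 4 * ?H\<^sup>2"
      using phase_bound[OF \<tau>(1)] phase_bound[OF \<tau>(2)] by linarith
    also have "\<dots> = c / 2 / C\<^sup>2 * (4 * ?H\<^sup>2 / (c / 2 / C\<^sup>2))"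
      using c(1) C by simp
    also have "\<dots> \<le> c / 2 / C\<^sup>2 * real (Suc (nat \<lceil>4 * ?H\<^sup>2 / (c / 2 / C\<^sup>2)\<rceil>))"
      using c(1) by (intro mult_left_mono) (simp_all add: of_nat_Suc, linarith)
    finally show "c / 2 / C\<^sup>2 \<le> \<bar>triple_phase \<tau> - triple_phase \<tau>'\<bar> \<and>
      \<bar>triple_phase \<tau> - triple_phase \<tau>'\<bar> \<le> c / 2 / C\<^sup>2 * real (Suc (nat \<lceil>4 * ?H\<^sup>2 / (c / 2 / C\<^sup>2)\<rceil>))"
      using lower by blast
  qed
  moreover have "K * 2 powr \<eta> > 0" "c / 2 > 0" using K(1) c(1) by simp_all
  ultimately show ?thesis by blast
qed

lemma card_int_pair_box_le:
  assumes "C \<ge> 1"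
  shows "real (card (int_pair_box C)) \<le> (3 * C)\<^sup>2"
proof -
  have "int_pair_box C \<subseteq> {-\<lfloor>C\<rfloor>..\<lfloor>C\<rfloor>} \<times> {-\<lfloor>C\<rfloor>..\<lfloor>C\<rfloor>}"
    by (auto simp: int_pair_box_def le_floor_iff abs_le_iff) linarith+
  then have "card (int_pair_box C) \<le> card ({-\<lfloor>C\<rfloor>..\<lfloor>C\<rfloor>} \<times> {-\<lfloor>C\<rfloor>..\<lfloor>C\<rfloor>})"
    by (intro card_mono) auto
  also have "\<dots> = (nat (2 * \<lfloor>C\<rfloor> + 1))\<^sup>2"
    by (simp add: card_cartesian_product power2_eq_square)
  finally have "real (card (int_pair_box C)) \<le> (real (nat (2 * \<lfloor>C\<rfloor> + 1)))\<^sup>2"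
    by (metis of_nat_le_iff of_nat_power)
  also have "\<dots> \<le> (3 * C)\<^sup>2"
    using assms by (intro power_mono) linarith+
  finally show ?thesis .
qed

section \<open>Strichartz estimate\<close>


lemma freq_vector_1:
  fixes w :: "real ^ 2"
  assumes "w = vector [1, \<omega>]"
  shows "freq w k = quadratic_emb \<omega> (k $ 1, k $ 2)"
  by (simp add: assms freq_def lattice_vec_def quadratic_emb_def inner_vec_def sum_2)

lemma inj_freq_vector_1:
  fixes w :: "real ^ 2"
  assumes "w = vector [1, \<omega>]" "\<omega> \<notin> \<rat>"
  shows "inj (freq w)"
proof (rule injI)
  fix k k' :: "int ^ 2" assume "freq w k = freq w k'"
  then have "(k $ 1, k $ 2) = (k' $ 1, k' $ 2)"
    using inj_quadratic_emb[OF assms(2)] by (simp add: freq_vector_1[OF assms(1)] inj_eq)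
  then show "k = k'" by (simp add: vec_eq_iff forall_2)
qed

lemma lattice_vec_in_box:
  fixes k :: "int ^ 2"
  assumes "norm (lattice_vec k) < C"
  shows "(k $ 1, k $ 2) \<in> int_pair_box C"
  using component_le_norm_cart[of "lattice_vec k" 1] component_le_norm_cart[of "lattice_vec k" 2] assms
  by (simp add: int_pair_box_def lattice_vec_def)

text \<open>The inverse of the separation is \<open>C\<^sup>2 / c\<close>, hence at most
  \<open>T / c\<close>. The logarithm is taken of a quantity of order \<open>C ^ 4\<close> and costs
  one factor \<open>C powr \<eta>\<close>; the multiplicity bound costs the other.\<close>

lemma strichartz_constant_bound:
  fixes \<eta> K c h :: real
  assumes "\<eta> > 0" "K > 0" "c > 0" "h \<ge> 1"
  shows "\<exists>B>0. \<forall>C\<ge>1. \<forall>T\<ge>C\<^sup>2.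
    (T + 2 * (1 + ln (real (Suc (nat \<lceil>4 * (C * h)\<^sup>2 / (c / C\<^sup>2)\<rceil>)))) / (c / C\<^sup>2)) * (4 + K * C powr \<eta>)
      \<le> B * T * C powr (2 * \<eta>)"
proof -
  \<comment> \<open>The summand 2 absorbs both \<open>Suc\<close> and the rounding up, so that the
    argument of the logarithm is at most \<open>A * C ^ 4\<close>.\<close>
  define A where "A = 4 * h\<^sup>2 / c + 2"
  define B where "B = (1 + 2 * (1 + ln A + 4 / \<eta>) / c) * (4 + K)"
  have A: "A \<ge> 1" using assms by (simp add: A_def)
  have B: "B > 0" using A assms by (simp add: B_def add_pos_nonneg)
  have "(T + 2 * (1 + ln (real (Suc (nat \<lceil>4 * (C * h)\<^sup>2 / (c / C\<^sup>2)\<rceil>)))) / (c / C\<^sup>2)) * (4 + K * C powr \<eta>)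
      \<le> B * T * C powr (2 * \<eta>)" if C: "C \<ge> 1" and T: "T \<ge> C\<^sup>2" for C T :: real
  proof -
    define q where "q = real (Suc (nat \<lceil>4 * (C * h)\<^sup>2 / (c / C\<^sup>2)\<rceil>))"
    have c1: "C powr \<eta> \<ge> 1" using C assms(1) by (simp add: ge_one_powr_ge_zero)
    have C4: "C ^ 4 \<ge> 1" using C by simp
    have "4 * (C * h)\<^sup>2 / (c / C\<^sup>2) = 4 * h\<^sup>2 / c * C ^ 4"
      using C by (simp add: power_mult_distrib power2_eq_square power4_eq_xxxx)
    moreover have "0 \<le> 4 * h\<^sup>2 / c * C ^ 4" using assms C by simp
    ultimately have "q \<le> 4 * h\<^sup>2 / c * C ^ 4 + 2" unfolding q_def by linarith
    also have "\<dots> \<le> A * C ^ 4" using C4 by (simp add: A_def distrib_right)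
    finally have "ln q \<le> ln (A * C ^ 4)" unfolding q_def by (intro ln_mono) auto
    also have "\<dots> = ln A + 4 * ln C" using A C by (simp add: ln_mult ln_realpow)
    also have "ln C \<le> C powr \<eta> / \<eta>" using C assms(1) by (rule ln_powr_bound)
    finally have "1 + ln q \<le> (1 + ln A) * 1 + 4 / \<eta> * C powr \<eta>" by simp
    also have "\<dots> \<le> (1 + ln A) * C powr \<eta> + 4 / \<eta> * C powr \<eta>"
      using c1 A by (intro add_right_mono mult_left_mono) auto
    finally have q: "1 + ln q \<le> (1 + ln A + 4 / \<eta>) * C powr \<eta>" by (simp add: distrib_right)
    have A0: "0 \<le> 1 + ln A + 4 / \<eta>" using A assms(1) by simp
    have "2 * (1 + ln q) / (c / C\<^sup>2) = 2 * C\<^sup>2 / c * (1 + ln q)" by simp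
    also have "\<dots> \<le> 2 * T / c * ((1 + ln A + 4 / \<eta>) * C powr \<eta>)"
    proof -
      have "0 \<le> ln (real (Suc m))" for m by simp
      then have "0 \<le> 1 + ln q" unfolding q_def by (simp only: add_nonneg_nonneg zero_le_one)
      moreover have "0 \<le> T" using T order_trans[OF zero_le_power2] by blast
      ultimately show ?thesis
        using T q assms(3) by (intro mult_mono divide_right_mono) auto
    qed
    also have "\<dots> = 2 * (1 + ln A + 4 / \<eta>) / c * (T * C powr \<eta>)" by simp
    finally have "T + 2 * (1 + ln q) / (c / C\<^sup>2) \<le> T * C powr \<eta> + 2 * (1 + ln A + 4 / \<eta>) / c * (T * C powr \<eta>)"
      using c1 T C mult_left_mono[of 1 "C powr \<eta>" T] order_trans[OF zero_le_power2 T] by simp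
    also have "\<dots> = (1 + 2 * (1 + ln A + 4 / \<eta>) / c) * (T * C powr \<eta>)" by (simp add: distrib_right)
    finally have 1: "T + 2 * (1 + ln q) / (c / C\<^sup>2) \<le> (1 + 2 * (1 + ln A + 4 / \<eta>) / c) * (T * C powr \<eta>)" .
    have 2: "4 + K * C powr \<eta> \<le> (4 + K) * C powr \<eta>" using c1 by (simp add: distrib_right)
    have "(T + 2 * (1 + ln q) / (c / C\<^sup>2)) * (4 + K * C powr \<eta>)
      \<le> ((1 + 2 * (1 + ln A + 4 / \<eta>) / c) * (T * C powr \<eta>)) * ((4 + K) * C powr \<eta>)"
      using 1 2 assms A0 order_trans[OF zero_le_power2 T]
      by (intro mult_mono) auto
    also have "\<dots> = B * T * (C powr \<eta> * C powr \<eta>)" by (simp add: B_def)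
    also have "C powr \<eta> * C powr \<eta> = C powr (2 * \<eta>)" by (simp flip: powr_add)
    finally show ?thesis by (simp only: q_def)
  qed
  then show ?thesis using B by blast
qed

text \<open>The number \<open>n\<close> of frequencies contributes \<open>C powr (p - 6)\<close>,
  and writing \<open>T\<close> as \<open>(T / C\<^sup>2) * C\<^sup>2\<close> contributes two more
  powers; \<open>p - 4 + p * \<epsilon>\<close> divided by \<open>p\<close> is the exponent
  claimed.\<close>

lemma strichartz_exponents:
  fixes C T p \<epsilon> B n :: real
  assumes C: "C \<ge> 1" and T: "T > 0" and p: "p \<ge> 6" and B: "B > 0" and n: "0 \<le> n" "n \<le> (3 * C)\<^sup>2"
    and G: "0 \<le> G" "G \<le> B * T * C powr (p * \<epsilon>)"
  shows "(n powr ((p - 6) / 2) * G) powr (1 / p)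
    \<le> (3 powr (p - 6) * B) powr (1 / p) * (T / C\<^sup>2) powr (1 / p) * C powr (1 - 4 / p + \<epsilon>)"
proof -
  have "n powr ((p - 6) / 2) \<le> ((3 * C)\<^sup>2) powr ((p - 6) / 2)"
    using n p by (intro powr_mono2) auto
  also have "\<dots> = ((3 * C) powr 2) powr ((p - 6) / 2)"
    using C by (simp add: powr_numeral)
  also have "\<dots> = (3 * C) powr (p - 6)"
    unfolding powr_powr by (rule arg_cong[where f = "(powr) (3 * C)"]) (simp add: field_simps)
  also have "\<dots> = 3 powr (p - 6) * C powr (p - 6)"
    using C by (simp add: powr_mult)
  finally have "n powr ((p - 6) / 2) * G \<le> (3 powr (p - 6) * C powr (p - 6)) * (B * T * C powr (p * \<epsilon>))"
    using G by (intro mult_mono) auto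
  also have "\<dots> = (3 powr (p - 6) * B) * (T / C\<^sup>2) * (C powr 2 * C powr (p - 6) * C powr (p * \<epsilon>))"
    using C by (simp add: powr_numeral)
  also have "C powr 2 * C powr (p - 6) * C powr (p * \<epsilon>) = C powr (p - 4 + p * \<epsilon>)"
    by (simp only: powr_add[symmetric]) (simp add: algebra_simps)
  finally have "(n powr ((p - 6) / 2) * G) powr (1 / p)
    \<le> ((3 powr (p - 6) * B) * (T / C\<^sup>2) * C powr (p - 4 + p * \<epsilon>)) powr (1 / p)"
    using G p by (intro powr_mono2) auto
  also have "\<dots> = (3 powr (p - 6) * B) powr (1 / p) * (T / C\<^sup>2) powr (1 / p) * (C powr (p - 4 + p * \<epsilon>)) powr (1 / p)"
    by (simp only: powr_mult)
  also have "(C powr (p - 4 + p * \<epsilon>)) powr (1 / p) = C powr (1 - 4 / p + \<epsilon>)"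
  proof -
    have "(p - 4 + p * \<epsilon>) * (1 / p) = 1 - 4 / p + \<epsilon>" using p by (simp add: field_simps)
    then show ?thesis by (simp only: powr_powr)
  qed
  finally show ?thesis .
qed

theorem theorem2:
  fixes \<epsilon> \<omega> p :: real and w :: "real ^ 2"
  assumes "\<epsilon> > 0"
    and "algebraic \<omega>" and "\<omega> \<notin> \<rat>" and "alg_degree \<omega> = 2"
    and "w = vector [1, \<omega>]"
    and "p \<ge> 6"
  shows "\<exists>K > 0. \<forall>C \<ge> 1. \<forall>T > C powr (2 + \<epsilon>). \<forall>f \<in> trig_polys w.
    mixed_norm p T (\<lambda>t. schroedinger w t (height_proj w C f))
    \<le> ennreal (K * (1 + (T / C\<^sup>2) powr (1 / p)) * C powr (1 - 4 / p + \<epsilon>))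
       * mean_norm 2 (height_proj w C f)"
proof -
  \<comment> \<open>The two losses of \<open>C powr \<eta>\<close> then combine to
    \<open>C powr (p * \<epsilon>)\<close>, that is \<open>C powr \<epsilon>\<close> after the
    \<open>p\<close>-th root.\<close>
  define \<eta> where "\<eta> = p * \<epsilon> / 2"
  have \<eta>: "\<eta> > 0" using assms(1,6) by (simp add: \<eta>_def)
  have inj: "inj (freq w)" by (rule inj_freq_vector_1[OF assms(5,3)])
  obtain K0 c where K0: "K0 > 0" and c: "c > 0" and FS: "\<And>C X. C \<ge> 1 \<Longrightarrow> X \<subseteq> quadratic_emb \<omega> ` int_pair_box C \<Longrightarrow>
    frequency_set X (K0 * C powr \<eta>) (c / C\<^sup>2) (Suc (nat \<lceil>4 * (C * (1 + \<bar>\<omega>\<bar>))\<^sup>2 / (c / C\<^sup>2)\<rceil>))"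
    using quadratic_frequency_set[OF assms(2,4,3) \<eta>] by blast
  obtain B where B: "B > 0" and bound: "\<And>C T. C \<ge> 1 \<Longrightarrow> T \<ge> C\<^sup>2 \<Longrightarrow>
    (T + 2 * (1 + ln (real (Suc (nat \<lceil>4 * (C * (1 + \<bar>\<omega>\<bar>))\<^sup>2 / (c / C\<^sup>2)\<rceil>)))) / (c / C\<^sup>2)) * (4 + K0 * C powr \<eta>)
      \<le> B * T * C powr (2 * \<eta>)"
    using strichartz_constant_bound[OF \<eta> K0 c, of "1 + \<bar>\<omega>\<bar>"] by auto
  define K where "K = (3 powr (p - 6) * B) powr (1 / p)"
  have K: "K > 0" using B by (simp add: K_def)
  have "mixed_norm p T (\<lambda>t. schroedinger w t (height_proj w C f))
    \<le> ennreal (K * (1 + (T / C\<^sup>2) powr (1 / p)) * C powr (1 - 4 / p + \<epsilon>)) * mean_norm 2 (height_proj w C f)"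
    if C: "C \<ge> 1" and T: "T > C powr (2 + \<epsilon>)" and f: "f \<in> trig_polys w" for C T f
  proof -
    obtain a0 where a0: "finite {k. a0 k \<noteq> 0}" "f = trig_sum w a0"
      using f by (auto simp: trig_polys_def)
    define b where "b k = (if C / 2 \<le> norm (lattice_vec k) \<and> norm (lattice_vec k) < C then a0 k else 0)" for k
    define S where "S = {k. b k \<noteq> 0}"
    have S: "finite S" unfolding S_def by (rule finite_subset[OF _ a0(1)]) (auto simp: b_def)
    have hp: "height_proj w C f = trig_sum w b"
      unfolding a0(2) height_proj_trig_sum[OF inj a0(1)] b_def ..
    define X where "X = freq w ` S"
    define a where "a \<xi> = b (inv (freq w) \<xi>)" for \<xi>
    have "X \<subseteq> quadratic_emb \<omega> ` int_pair_box C"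
      using lattice_vec_in_box unfolding X_def S_def b_def
      by (fastforce simp: freq_vector_1[OF assms(5)] split: if_splits)
    note X = this
    \<comment> \<open>From here on the length of the time interval enters through this comparison
      with the inverse separation of the phases.\<close>
    have CT: "C\<^sup>2 \<le> T"
    proof -
      have "C powr 2 \<le> C powr (2 + \<epsilon>)" using C assms(1) by (intro powr_mono) auto
      then show ?thesis using T C by (simp add: powr_numeral)
    qed
    then have T0: "T > 0" using C by (smt (verit) one_le_power)
    have ln_nonneg: "0 \<le> ln (real (Suc m))" for m by simp
    interpret frequency_set X a "K0 * C powr \<eta>" "c / C\<^sup>2" "Suc (nat \<lceil>4 * (C * (1 + \<bar>\<omega>\<bar>))\<^sup>2 / (c / C\<^sup>2)\<rceil>)"
      by (rule FS[OF C X])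
    have sol: "schroedinger w t (height_proj w C f) = solution t" for t
    proof
      fix x
      have "schroedinger w t (height_proj w C f) x
        = (\<Sum>k\<in>S. b k * cis (2 * pi * (freq w k * x + (freq w k)\<^sup>2 * t)))"
        unfolding hp schroedinger_def trig_coeff_trig_sum[OF inj S[unfolded S_def]] S_def[symmetric]
        by (simp only: power2_abs mult.commute)
      also have "\<dots> = solution t x"
        unfolding solution_def unfolding X_def a_def
        by (rule trig_sum_reindex[OF inj, of b "\<lambda>\<xi>. 2 * pi * (\<xi> * x + \<xi>\<^sup>2 * t)"])
      finally show "schroedinger w t (height_proj w C f) x = solution t x" .
    qed
    have mean: "mean_norm 2 (height_proj w C f) = ennreal (sqrt energy)"
      unfolding energy_def
    proof (rule mean_norm_2_trig[OF fin])
      fix x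
      show "height_proj w C f x = (\<Sum>\<xi>\<in>X. a \<xi> * cis (2 * pi * \<xi> * x))"
        unfolding hp trig_sum_def X_def a_def S_def[symmetric]
        by (rule trig_sum_reindex[OF inj, of b "\<lambda>\<xi>. 2 * pi * \<xi> * x"])
    qed
    have "card X \<le> card (quadratic_emb \<omega> ` int_pair_box C)"
      using X by (intro card_mono) auto
    also have "\<dots> \<le> card (int_pair_box C)" by (rule card_image_le) simp
    finally have card_X: "real (card X) \<le> (3 * C)\<^sup>2"
      using card_int_pair_box_le[OF C] by linarith
    have "mixed_norm p T (\<lambda>t. schroedinger w t (height_proj w C f))
      \<le> ennreal ((real (card X) powr ((p - 6) / 2)
        * ((T + 2 * (1 + ln (real (Suc (nat \<lceil>4 * (C * (1 + \<bar>\<omega>\<bar>))\<^sup>2 / (c / C\<^sup>2)\<rceil>)))) / (c / C\<^sup>2))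
          * (4 + K0 * C powr \<eta>))) powr (1 / p) * sqrt energy)"
      unfolding sol using mixed_norm_solution_le[OF assms(6)] T0 by simp
    also have "\<dots> \<le> ennreal ((K * (1 + (T / C\<^sup>2) powr (1 / p)) * C powr (1 - 4 / p + \<epsilon>)) * sqrt energy)"
    proof (intro ennreal_leI mult_right_mono)
      have "(real (card X) powr ((p - 6) / 2)
        * ((T + 2 * (1 + ln (real (Suc (nat \<lceil>4 * (C * (1 + \<bar>\<omega>\<bar>))\<^sup>2 / (c / C\<^sup>2)\<rceil>)))) / (c / C\<^sup>2))
          * (4 + K0 * C powr \<eta>))) powr (1 / p)
        \<le> K * (T / C\<^sup>2) powr (1 / p) * C powr (1 - 4 / p + \<epsilon>)"
        unfolding K_def
      proof (rule strichartz_exponents[OF C T0 assms(6) B _ card_X])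
        show "0 \<le> (T + 2 * (1 + ln (real (Suc (nat \<lceil>4 * (C * (1 + \<bar>\<omega>\<bar>))\<^sup>2 / (c / C\<^sup>2)\<rceil>)))) / (c / C\<^sup>2))
          * (4 + K0 * C powr \<eta>)"
          using T0 K0 c by (intro mult_nonneg_nonneg add_nonneg_nonneg divide_nonneg_nonneg ln_nonneg) auto
        show "(T + 2 * (1 + ln (real (Suc (nat \<lceil>4 * (C * (1 + \<bar>\<omega>\<bar>))\<^sup>2 / (c / C\<^sup>2)\<rceil>)))) / (c / C\<^sup>2))
          * (4 + K0 * C powr \<eta>) \<le> B * T * C powr (p * \<epsilon>)"
          using bound[OF C CT] by (simp add: \<eta>_def)
      qed simp
      also have "\<dots> \<le> K * (1 + (T / C\<^sup>2) powr (1 / p)) * C powr (1 - 4 / p + \<epsilon>)"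
        using K by (intro mult_right_mono mult_left_mono) auto
      finally show "(real (card X) powr ((p - 6) / 2)
        * ((T + 2 * (1 + ln (real (Suc (nat \<lceil>4 * (C * (1 + \<bar>\<omega>\<bar>))\<^sup>2 / (c / C\<^sup>2)\<rceil>)))) / (c / C\<^sup>2))
          * (4 + K0 * C powr \<eta>))) powr (1 / p)
        \<le> K * (1 + (T / C\<^sup>2) powr (1 / p)) * C powr (1 - 4 / p + \<epsilon>)" .
    qed (simp add: energy_nonneg)
    also have "\<dots> = ennreal (K * (1 + (T / C\<^sup>2) powr (1 / p)) * C powr (1 - 4 / p + \<epsilon>)) * mean_norm 2 (height_proj w C f)"
      unfolding mean using K by (intro ennreal_mult) (auto simp: energy_nonneg)
    finally show ?thesis .
  qed
  then show ?thesis using K by blast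
qed

end
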